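(* The dynamical system $F_{ang}$ has exactly two fixed points in $\Xi_{\mathcal W}/V_T$ at which the Hamiltonian vanishes. They are the switching points $q_{out},q_{in}$ of outward and inward triangular spirals. They are related by time-reversing symmetry: $\tau(q_{out})=q_{in}$. After rescaling by the virial group $\mathcal G$ to make the real part of the first coordinate equal to $-1$, the fixed point $q_{out}$ takes the form (modulo $\mathcal G$) $$q_{out}\equiv\Big(-1+i\frac{-1+r}{\sqrt3(1+r)},\ -\frac{-1+r^3}{\sqrt3(1+r^3)}+i\frac{1-3r-2r^2-3r^3+r^4}{3(1+r+r^3+r^4)},$$ $$\qquad\frac{-2(1+r-4r^3-7r^4-9r^5-7r^6-4r^7+r^9+r^{10})}{9(1+r)^2(1-r+r^2)(1+r^3+r^6)}\Big),$$ where $r=r_{scale}\approx6.27$ is the unique real root greater than $1$ of the palindromic polynomial $1-5r-7r^2-5r^3-7r^4-5r^5+r^6$. The first positive switching time for the initial conditions given by the right-hand side is $t_{sw}=\frac{2(1+r+r^2)}{\sqrt3(r+1)}\approx7.4$.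
   Context: Let $\zeta=\exp(2\pi i/3)$, $V_T=\{1,\zeta,\zeta^2\}$, and $\mathrm{Re}(a,b):=\mathrm{Re}(\bar ab)$ for $a,b\in\mathbb C$. The Fuller system with triangular control is $z_3'=z_2$, $z_2'=z_1$, $z_1'=-iu$, $u(t)\in V_T$, with Hamiltonian $\mathcal H_F(z,u)=\mathrm{Re}(z_1,iz_2)+\mathrm{Re}(u,z_3)$; the control is chosen by the maximum principle: $u(t)$ maximizes $\mathcal H_F(z(t),\cdot)$ over $V_T$. The Hamiltonian vanishes at $z$ if $\max_{u\in V_T}\mathcal H_F(z,u)=0$. Walls: $\mathcal W=\mathbb R_{\le0}\cup\mathbb R_{\le0}\zeta\cup\mathbb R_{\le0}\zeta^2$ (switching occurs only when $z_3\in\mathcal W$). For $z^0\in\mathbb C^3\setminus\{0\}$ with $z_3^0\in\mathcal W$, the first control $u$ is the element of $V_T$ whose vector $(\mathrm{Re}(z_3^0,u),\mathrm{Re}(z_2^0,u),\mathrm{Re}(z_1^0,u))$ is lexicographically maximal; if two elements $\zeta^i,\zeta^{i+1}$ tie, it is $\zeta^i$. Let $z(t)$ be the solution with $z(0)=z^0$ and constant control $u$; the first positive switching time $t_{sw}>0$ is the least $t>0$ at which $\mathrm{Re}(u-u',z_3(t))=0$ for some $u'\in V_T\setminus\{u\}$. The Fuller–Poincaré map is $F(z^0)=z(t_{sw})$. The virial group $\mathcal G=V_T\times\mathbb R_{>0}$ acts by $(\zeta^k,r)\cdot(z_1,z_2,z_3)=(\zeta^krz_1,\zeta^kr^2z_2,\zeta^kr^3z_3)$;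 $F$ commutes with it. Let $\phi(z)=(|z_1|^6+|z_2|^3+|z_3|^2)^{1/6}$, $\Xi=\{\xi\in\mathbb C^3:\phi(\xi)=1\}$, $\Xi_{\mathcal W}=\{\xi\in\Xi:\xi_3\in\mathcal W\}$. Each $z\ne0$ is uniquely $(r\xi_1,r^2\xi_2,r^3\xi_3)$ with $r=\phi(z)>0$, $\xi\in\Xi$ (the angular component). $F_{ang}:\Xi_{\mathcal W}/V_T\to\Xi_{\mathcal W}/V_T$ sends $\xi$ to the angular component of $F(\xi)$ (modulo the diagonal $V_T$-action). The time-reversal symmetry is $\tau(z_1,z_2,z_3)=(\bar z_1,-\bar z_2,\bar z_3)$. A triangular spiral is a trajectory whose consecutive switching points are related by a fixed element of $\mathcal G$, $z_j(t_{sw})=r^j\zeta_1z_j(0)$ with $\zeta_1\in V_T$; it is outward if $r>1$ and inward if $r<1$. *)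

theory Defs
  imports "HOL-Analysis.Analysis" "HOL-Computational_Algebra.Polynomial"
begin

type_synonym state = "complex \<times> complex \<times> complex"

definition zeta :: complex where
  "zeta = exp (2 * of_real pi * \<i> / 3)"

definition V_T :: "complex set" where
  "V_T = {1, zeta, zeta ^ 2}"

definition Re_pair :: "complex \<Rightarrow> complex \<Rightarrow> real" where
  "Re_pair a b = Re (cnj a * b)"

definition comp1 :: "state \<Rightarrow> complex" where "comp1 = (\<lambda>(z1, z2, z3). z1)"
definition comp2 :: "state \<Rightarrow> complex" where "comp2 = (\<lambda>(z1, z2, z3). z2)"
definition comp3 :: "state \<Rightarrow> complex" where "comp3 = (\<lambda>(z1, z2, z3). z3)"


definition fuller_field :: "complex \<Rightarrow> state \<Rightarrow> state" where
  "fuller_field u = (\<lambda>(z1, z2, z3). (- \<i> * u, z1, z2))"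

definition solves_fuller :: "complex \<Rightarrow> real set \<Rightarrow> (real \<Rightarrow> state) \<Rightarrow> bool" where
  "solves_fuller u T z \<longleftrightarrow>
     (\<forall>t\<in>T. (z has_vector_derivative fuller_field u (z t)) (at t within T))"

definition fuller_ham :: "state \<Rightarrow> complex \<Rightarrow> real" where
  "fuller_ham z u = Re_pair (comp1 z) (\<i> * comp2 z) + Re_pair u (comp3 z)"

definition ham_vanishes :: "state \<Rightarrow> bool" where
  "ham_vanishes z \<longleftrightarrow> Max (fuller_ham z ` V_T) = 0"

definition walls :: "complex set" where
  "walls = {of_real x * w | x w. x \<le> 0 \<and> w \<in> V_T}"


definition lex_le :: "real \<times> real \<times> real \<Rightarrow> real \<times> real \<times> real \<Rightarrow> bool" where
  "lex_le = (\<lambda>(a, b, c) (a', b', c'). a < a' \<or> a = a' \<and> (b < b' \<or> b = b' \<and> c \<le> c'))"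

definition control_vector :: "state \<Rightarrow> complex \<Rightarrow> real \<times> real \<times> real" where
  "control_vector z u = (Re_pair (comp3 z) u, Re_pair (comp2 z) u, Re_pair (comp1 z) u)"

definition lex_maximal :: "state \<Rightarrow> complex \<Rightarrow> bool" where
  "lex_maximal z u \<longleftrightarrow>
     u \<in> V_T \<and> (\<forall>v\<in>V_T. lex_le (control_vector z v) (control_vector z u))"

text \<open>The second conjunct is the tie-break: among two maximal elements \<open>w\<close> and \<open>zeta * w\<close>
  the first one is chosen. For \<open>z \<noteq> 0\<close> the three vectors cannot all coincide, so
  the description is unique.\<close>

definition first_control :: "state \<Rightarrow> complex" where
  "first_control z =
     (THE u. lex_maximal z u \<and> (\<forall>v. lex_maximal z v \<longrightarrow> v = u \<or> v = zeta * u))"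

definition flow :: "complex \<Rightarrow> state \<Rightarrow> real \<Rightarrow> state" where
  "flow u z0 = (THE z. z 0 = z0 \<and> solves_fuller u UNIV z)"

definition t_sw :: "state \<Rightarrow> real" where
  "t_sw z0 = (let u = first_control z0 in
     LEAST t. t > 0 \<and> (\<exists>v \<in> V_T - {u}. Re_pair (u - v) (comp3 (flow u z0 t)) = 0))"

definition fuller_map :: "state \<Rightarrow> state" where
  "fuller_map z0 = flow (first_control z0) z0 (t_sw z0)"


definition virial_group :: "(complex \<times> real) set" where
  "virial_group = V_T \<times> {0<..}"

definition virial :: "complex \<times> real \<Rightarrow> state \<Rightarrow> state" where
  "virial = (\<lambda>(w, r) (z1, z2, z3).
     (w * of_real r * z1, w * of_real (r ^ 2) * z2, w * of_real (r ^ 3) * z3))"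

definition phi :: "state \<Rightarrow> real" where
  "phi z = (cmod (comp1 z) ^ 6 + cmod (comp2 z) ^ 3 + cmod (comp3 z) ^ 2) powr (1 / 6)"

definition Xi_W :: "state set" where
  "Xi_W = {\<xi>. phi \<xi> = 1 \<and> comp3 \<xi> \<in> walls}"

definition ang :: "state \<Rightarrow> state" where
  "ang z = virial (1, inverse (phi z)) z"

definition V_rel :: "(state \<times> state) set" where
  "V_rel = {(\<xi>, \<eta>). \<xi> \<in> Xi_W \<and> \<eta> \<in> Xi_W \<and> (\<exists>w\<in>V_T. \<eta> = virial (w, 1) \<xi>)}"

text \<open>The map induced on orbits. The union is over the representatives of one orbit; it is
  a single orbit because \<open>fuller_map\<close> commutes with the virial group.\<close>

definition F_ang :: "state set \<Rightarrow> state set" where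
  "F_ang X = (\<Union>\<xi>\<in>X. V_rel `` {ang (fuller_map \<xi>)})"

definition tau :: "state \<Rightarrow> state" where
  "tau = (\<lambda>(z1, z2, z3). (cnj z1, - cnj z2, cnj z3))"


text \<open>A trajectory \<open>z\<close> starting at a switching point, with successive switching times
  \<open>s 0 = 0 < s 1 < s 2 < \<dots>\<close>. The values of \<open>z\<close> are only constrained on the union of the
  intervals \<open>[s n, s (n + 1)]\<close>, which is bounded when the switching times accumulate.\<close>

definition fuller_trajectory :: "(real \<Rightarrow> state) \<Rightarrow> (nat \<Rightarrow> real) \<Rightarrow> bool" where
  "fuller_trajectory z s \<longleftrightarrow> s 0 = 0 \<and>
     (\<forall>n. z (s n) \<noteq> 0 \<and> comp3 (z (s n)) \<in> walls \<and>
          s (Suc n) = s n + t_sw (z (s n)) \<and> s n < s (Suc n) \<and>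
          (let u = first_control (z (s n)) in
             solves_fuller u {s n..s (Suc n)} z \<and>
             (\<forall>t\<in>{s n..s (Suc n)}. is_arg_max (fuller_ham (z t)) (\<lambda>v. v \<in> V_T) u)))"

definition triangular_spiral ::
    "(real \<Rightarrow> state) \<Rightarrow> (nat \<Rightarrow> real) \<Rightarrow> complex \<times> real \<Rightarrow> bool" where
  "triangular_spiral z s g \<longleftrightarrow>
     fuller_trajectory z s \<and> g \<in> virial_group \<and> (\<forall>n. z (s (Suc n)) = virial g (z (s n)))"

definition outward_spiral ::
    "(real \<Rightarrow> state) \<Rightarrow> (nat \<Rightarrow> real) \<Rightarrow> complex \<times> real \<Rightarrow> bool" where
  "outward_spiral z s g \<longleftrightarrow> triangular_spiral z s g \<and> snd g > 1"

definition inward_spiral ::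
    "(real \<Rightarrow> state) \<Rightarrow> (nat \<Rightarrow> real) \<Rightarrow> complex \<times> real \<Rightarrow> bool" where
  "inward_spiral z s g \<longleftrightarrow> triangular_spiral z s g \<and> snd g < 1"


definition spiral_poly :: "real poly" where
  "spiral_poly = [:1, -5, -7, -5, -7, -5, 1:]"

definition r_scale :: real where
  "r_scale = (THE r. r > 1 \<and> poly spiral_poly r = 0)"

definition q_rep :: "real \<Rightarrow> state" where
  "q_rep r =
     (Complex (-1) ((-1 + r) / (sqrt 3 * (1 + r))),
      Complex (- ((-1 + r ^ 3) / (sqrt 3 * (1 + r ^ 3))))
              ((1 - 3 * r - 2 * r ^ 2 - 3 * r ^ 3 + r ^ 4) / (3 * (1 + r + r ^ 3 + r ^ 4))),
      of_real (- 2 * (1 + r - 4 * r ^ 3 - 7 * r ^ 4 - 9 * r ^ 5 - 7 * r ^ 6 - 4 * r ^ 7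
                        + r ^ 9 + r ^ 10)
               / (9 * (1 + r) ^ 2 * (1 - r + r ^ 2) * (1 + r ^ 3 + r ^ 6))))"

end

theory Submission
  imports Defs
begin

text \<open>On an arc with constant control \<open>u\<close> the state is an explicit cubic in time, and switching is governed by
  the signs of the gaps \<open>Re (cnj (u - v) * z3)\<close>. Rotated so that the control is 1, a fixed point of
  the angular map solves three linear equations \<open>z(T) = (w r z1, w r\<^sup>2 z2, w r\<^sup>3 z3)\<close>. The case \<open>w = 1\<close> is
  impossible, and \<open>w = zeta\<close> is carried by the reflection \<open>z \<mapsto> - cnj z\<close> to the case \<open>w = zeta\<^sup>2\<close>, but with
  the wrong sign of \<open>z3\<close>. For \<open>w = zeta\<^sup>2\<close> the first two equations and the scale determine \<open>z1\<close> and \<open>z2\<close>, the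
  vanishing of the Hamiltonian determines \<open>z3\<close>, and the third equation becomes the
  palindromic sextic, whose only positive roots are \<open>r_scale\<close> and its inverse. That \<open>T\<close> is really
  the first switching time reduces to a negative discriminant, that is to
  \<open>r ^ 4 - 3 * r ^ 3 - 20 * r ^ 2 - 3 * r + 1 > 0\<close>, which holds at these roots by a narrow margin.\<close>

section \<open>Cube roots of unity and the spiral polynomial\<close>

lemma zeta_eq: "zeta = Complex (- 1 / 2) (sqrt 3 / 2)"
  by (simp add: zeta_def complex_eq_iff Re_exp Im_exp cos_120 sin_120)

lemma zeta_sq: "zeta ^ 2 = Complex (- 1 / 2) (- sqrt 3 / 2)"
  by (simp add: zeta_eq complex_eq_iff power2_eq_square)

lemma zeta_simps [simp]:
  "Re zeta = - 1 / 2" "Im zeta = sqrt 3 / 2"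
  "Re (zeta\<^sup>2) = - 1 / 2" "Im (zeta\<^sup>2) = - sqrt 3 / 2"
  by (simp_all only: zeta_sq) (simp_all add: zeta_eq)

lemma zeta_cube: "zeta ^ 3 = 1"
proof -
  have "zeta ^ 3 = zeta * zeta ^ 2" by (simp add: power3_eq_cube power2_eq_square)
  also have "\<dots> = 1" unfolding zeta_sq by (simp add: zeta_eq complex_eq_iff)
  finally show ?thesis .
qed

lemma zeta_mult: "zeta * zeta = zeta\<^sup>2" "zeta * zeta\<^sup>2 = 1" "zeta\<^sup>2 * zeta = 1" "zeta\<^sup>2 * zeta\<^sup>2 = zeta"
  using zeta_cube by (simp_all add: power2_eq_square power3_eq_cube mult.assoc)

lemma zeta_power_4: "zeta ^ 4 = zeta"
  using zeta_mult(4) by (simp flip: power_add)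

lemma cnj_zeta: "cnj zeta = zeta\<^sup>2"
  unfolding complex_eq_iff by simp

lemma zeta_distinct: "zeta \<noteq> 1" "1 \<noteq> zeta" "zeta\<^sup>2 \<noteq> 1" "1 \<noteq> zeta\<^sup>2" "zeta\<^sup>2 \<noteq> zeta" "zeta \<noteq> zeta\<^sup>2"
  unfolding complex_eq_iff by simp_all

lemma V_T_E:
  assumes "w \<in> V_T"
  obtains "w = 1" | "w = zeta" | "w = zeta\<^sup>2"
  using assms by (auto simp: V_T_def)

lemma V_T_I [simp]: "1 \<in> V_T" "zeta \<in> V_T" "zeta\<^sup>2 \<in> V_T"
  by (auto simp: V_T_def)

lemma finite_V_T [simp]: "finite V_T"
  by (simp add: V_T_def)

lemma V_T_mult: "w \<in> V_T \<Longrightarrow> v \<in> V_T \<Longrightarrow> w * v \<in> V_T"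
  by (auto simp: V_T_def zeta_mult zeta_power_4)

lemma V_T_power: "w \<in> V_T \<Longrightarrow> w ^ n \<in> V_T"
  by (induction n) (auto intro: V_T_mult)

lemma V_T_cnj: "w \<in> V_T \<Longrightarrow> cnj w \<in> V_T"
  by (auto simp: V_T_def cnj_zeta zeta_power_4)

lemma V_T_cnj_mult: "w \<in> V_T \<Longrightarrow> cnj w * w = 1" "w \<in> V_T \<Longrightarrow> w * cnj w = 1"
  by (auto simp: V_T_def zeta_mult zeta_power_4 cnj_zeta)

lemma V_T_norm: "w \<in> V_T \<Longrightarrow> cmod w = 1"
  using complex_norm_square[of w] by (simp add: V_T_cnj_mult power2_eq_1_iff flip: of_real_power)
    (metis norm_ge_zero not_one_le_zero of_real_eq_1_iff power2_eq_1_iff neg_0_le_iff_le)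

lemma V_T_others: "u \<in> V_T \<Longrightarrow> V_T - {u} = {zeta * u, zeta\<^sup>2 * u}"
  by (auto simp: V_T_def zeta_mult zeta_power_4 zeta_distinct)

lemma V_T_all_distinct: 
  assumes "u \<in> V_T" 
  shows "zeta * u \<noteq> u" "zeta\<^sup>2 * u \<noteq> u" "zeta * u \<noteq> zeta\<^sup>2 * u"
proof -
  have "u \<noteq> 0" using V_T_norm[OF assms] by auto
  then show "zeta * u \<noteq> u" "zeta\<^sup>2 * u \<noteq> u" "zeta * u \<noteq> zeta\<^sup>2 * u"
    unfolding mult_cancel_right1 mult_cancel_right mult_cancel_right2
    by (simp_all only: zeta_distinct simp_thms)
qed

section \<open>The palindromic sextic and its positive roots\<close>

lemma spiral_poly_eval:
  "poly spiral_poly r = 1 - 5 * r - 7 * r ^ 2 - 5 * r ^ 3 - 7 * r ^ 4 - 5 * r ^ 5 + r ^ 6"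
  by (simp add: spiral_poly_def algebra_simps numeral_eq_Suc)

text \<open>Being palindromic, the sextic divided by \<open>r ^ 3\<close> is a cubic in
  \<open>r + 1 / r\<close>. This makes the symmetry of the roots under inversion evident and reduces
  their count to degree three.\<close>

lemma spiral_poly_cubic:
  fixes r :: real
  assumes "r \<noteq> 0"
  defines "s \<equiv> r + 1 / r"
  shows "poly spiral_poly r = r ^ 3 * (s ^ 3 - 5 * s ^ 2 - 10 * s + 5)"
proof -
  have rs: "r * s = r\<^sup>2 + 1" using assms by (simp add: s_def power2_eq_square field_simps)
  have "r ^ 3 * (s ^ 3 - 5 * s ^ 2 - 10 * s + 5)
      = (r * s) ^ 3 - 5 * r * (r * s) ^ 2 - 10 * r ^ 2 * (r * s) + 5 * r ^ 3" 
    by algebra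
  also have "\<dots> = poly spiral_poly r" unfolding rs spiral_poly_eval by algebra
  finally show ?thesis ..
qed

lemma spiral_root_inverse:
  assumes "poly spiral_poly r = 0" "r \<noteq> 0"
  shows "poly spiral_poly (1 / r) = 0"
  using assms by (simp add: spiral_poly_cubic add.commute)

text \<open>A root above 1 gives \<open>s > 5\<close>, because the cubic equation reads
  \<open>s^2 (s - 5) = 10 s - 5\<close> and the right side is positive. Above 5 the difference
  quotient of the cubic is positive, so \<open>s\<close> is determined; and \<open>s\<close>
  determines the root above 1, since the two solutions of \<open>r + 1 / r = s\<close> have product
  1.\<close>

lemma spiral_root_unique:
  assumes a: "poly spiral_poly a = 0" "a > 1" and b: "poly spiral_poly b = 0" "b > 1"
  shows "a = b"
proof -
  define f where "f s = s ^ 3 - 5 * s ^ 2 - 10 * s + (5::real)" for s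
  have gt5: "f (r + 1 / r) = 0 \<and> r + 1 / r > 5" if "poly spiral_poly r = 0" "r > 1" for r
  proof -
    define s where "s = r + 1 / r"
    have f0: "f s = 0" using that by (simp add: spiral_poly_cubic f_def s_def)
    have "1 / r > 0" using that by simp
    then have "s > 1" using that unfolding s_def by linarith
    moreover have "s\<^sup>2 * (s - 5) = f s + 10 * s - 5" unfolding f_def by algebra
    ultimately have "s\<^sup>2 * (s - 5) > 0" using f0 by linarith
    then have "s > 5" by (simp add: zero_less_mult_iff)
    then show ?thesis using f0 by (simp add: s_def)
  qed
  define s t where "s = a + 1 / a" and "t = b + 1 / b"
  have s: "f s = 0" "s > 5" and t: "f t = 0" "t > 5"
    using gt5[of a] gt5[of b] a b by (auto simp: s_def t_def)
  have "(s - t) * (s\<^sup>2 + s * t + t\<^sup>2 - 5 * s - 5 * t - 10) = f s - f t"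
    unfolding f_def by algebra
  moreover have "s * s > 5 * s" "t * t > 5 * t" "s * t > 5 * 5"
    using s t mult_strict_mono[of 5 s 5 t] by simp_all
  ultimately have "s = t" using s t by (auto simp: power2_eq_square)
  have "a * (1 / a) = 1" "b * (1 / b) = 1" using a b by simp_all
  then have "(a - b) * (a * b - 1) = a * b * (s - t)"
    unfolding s_def t_def by algebra
  then have "(a - b) * (a * b - 1) = 0" using \<open>s = t\<close> by simp
  moreover have "a * b > 1" using a b by (simp add: less_1_mult)
  ultimately show ?thesis by simp
qed

text \<open>The bracket is narrow enough for the accuracy 0.005 of the final statement, and its
  lower end is high enough for \<open>spiral_ratio_quartic\<close>.\<close>

lemma spiral_root_exists: "\<exists>r::real. 6.27 \<le> r \<and> r \<le> 6.2749 \<and> poly spiral_poly r = 0"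
  by (rule IVT) (simp_all add: spiral_poly_eval power_divide)

lemma r_scale_props: "r_scale > 1" "poly spiral_poly r_scale = 0" "6.27 \<le> r_scale" "r_scale \<le> 6.2749"
  and spiral_root_ex1: "\<exists>!r::real. r > 1 \<and> poly spiral_poly r = 0"
proof -
  obtain r :: real where r: "6.27 \<le> r" "r \<le> 6.2749" "poly spiral_poly r = 0"
    using spiral_root_exists by blast
  then have ex1: "\<exists>!r::real. r > 1 \<and> poly spiral_poly r = 0"
    by (intro ex1I[of _ r]) (auto intro: spiral_root_unique)
  then show "\<exists>!r::real. r > 1 \<and> poly spiral_poly r = 0" .
  have "r_scale = r"
    unfolding r_scale_def by (rule the1_equality[OF ex1]) (use r in auto)
  then show "r_scale > 1" "poly spiral_poly r_scale = 0" "6.27 \<le> r_scale" "r_scale \<le> 6.2749"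
    using r by auto
qed

text \<open>The scale factors of both spirals at once, so that the outward and the inward spiral
  share the coordinate computations below.\<close>

definition spiral_ratio :: "real \<Rightarrow> bool" where
  "spiral_ratio r \<longleftrightarrow> r > 0 \<and> poly spiral_poly r = 0"

text \<open>A root between 0 and 1 becomes a root above 1 by inversion, and 1 itself is not a
  root.\<close>

lemma spiral_ratio_iff: "spiral_ratio r \<longleftrightarrow> r = r_scale \<or> r = 1 / r_scale"
proof
  assume "spiral_ratio r"
  then have r: "r > 0" "poly spiral_poly r = 0" by (auto simp: spiral_ratio_def)
  have "r \<noteq> 1" using r by (auto simp: spiral_poly_eval)
  then consider "r > 1" | "1 / r > 1" using r by fastforce
  then show "r = r_scale \<or> r = 1 / r_scale"
  proof cases
    case 1
    then show ?thesis using spiral_root_unique[of r r_scale] r r_scale_props by auto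
  next
    case 2
    then have "1 / r = r_scale"
      using spiral_root_unique[of "1 / r" r_scale] spiral_root_inverse r r_scale_props by auto
    then have "r = 1 / r_scale" using r(1) by (metis divide_divide_eq_right div_by_1 mult_1)
    then show ?thesis ..
  qed
next
  assume "r = r_scale \<or> r = 1 / r_scale"
  then show "spiral_ratio r"
    using r_scale_props spiral_root_inverse[of r_scale] by (auto simp: spiral_ratio_def)
qed

text \<open>The quartic is palindromic too, so it has the same sign at \<open>1 / R\<close> as at
  \<open>R\<close>. Its Taylor coefficients at 6.27 are all positive, the constant one being only
  about 2 although its summands reach 1500.\<close>

lemma spiral_ratio_quartic:
  assumes "spiral_ratio r"
  shows "r ^ 4 - 3 * r ^ 3 - 20 * r ^ 2 - 3 * r + 1 > 0"
proof -
  define R where "R = r_scale"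
  define x where "x = R - 6.27"
  have x: "x \<ge> 0" "R = 6.27 + x" using r_scale_props by (auto simp: x_def R_def)
  have "R ^ 4 - 3 * R ^ 3 - 20 * R ^ 2 - 3 * R + 1 > 0"
  proof -
    have "R ^ 4 - 3 * R ^ 3 - 20 * R ^ 2 - 3 * R + 1 
       = (6.27 ^ 4 - 3 * 6.27 ^ 3 - 20 * 6.27 ^ 2 - 3 * 6.27 + 1)
         + (4 * 6.27 ^ 3 - 9 * 6.27 ^ 2 - 40 * 6.27 - 3) * x
         + (6 * 6.27 ^ 2 - 9 * 6.27 - 20) * x ^ 2 + (4 * 6.27 - 3) * x ^ 3 + x ^ 4"
      unfolding x(2) by algebra
    also have "\<dots> > 0" using x(1) by (intro add_pos_nonneg mult_nonneg_nonneg) (simp_all add: power_divide)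
    finally show ?thesis .
  qed
  moreover have "(1/R) ^ 4 - 3 * (1/R) ^ 3 - 20 * (1/R) ^ 2 - 3 * (1/R) + 1
      = (R ^ 4 - 3 * R ^ 3 - 20 * R ^ 2 - 3 * R + 1) / R ^ 4"
  proof -
    have "1 / R * R = 1" using r_scale_props(1) by (simp add: R_def)
    then have "((1/R) ^ 4 - 3 * (1/R) ^ 3 - 20 * (1/R) ^ 2 - 3 * (1/R) + 1) * R ^ 4
      = R ^ 4 - 3 * R ^ 3 - 20 * R ^ 2 - 3 * R + 1" by algebra
    then show ?thesis using r_scale_props(1) by (simp add: R_def eq_divide_eq)
  qed
  moreover have "R > 0" using r_scale_props(1) by (simp add: R_def)
  ultimately show ?thesis using assms by (auto simp: spiral_ratio_iff R_def)
qed

section \<open>Constant-control arcs and the switching rule\<close>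

text \<open>The solution for constant control: each coordinate is the integral of the preceding one,
  beginning with the constant derivative \<open>- \<i> * u\<close>.\<close>

definition fuller_arc :: "complex \<Rightarrow> state \<Rightarrow> real \<Rightarrow> state" where
  "fuller_arc u = (\<lambda>(z1, z2, z3) t.
     (z1 - \<i> * u * of_real t,
      z2 + z1 * of_real t - \<i> * u * of_real t ^ 2 / 2,
      z3 + z2 * of_real t + z1 * of_real t ^ 2 / 2 - \<i> * u * of_real t ^ 3 / 6))"

lemma comp_simps [simp]:
  "comp1 (z1, z2, z3) = z1" "comp2 (z1, z2, z3) = z2" "comp3 (z1, z2, z3) = z3"
  by (simp_all add: comp1_def comp2_def comp3_def)

lemma arc_0 [simp]: "fuller_arc u z 0 = z"
  by (cases z) (simp add: fuller_arc_def)

lemma has_vector_derivative_Pair: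
  assumes "(f has_vector_derivative f') (at t within S)" "(g has_vector_derivative g') (at t within S)"
  shows "((\<lambda>t. (f t, g t)) has_vector_derivative (f', g')) (at t within S)"
  using has_derivative_Pair[OF assms[unfolded has_vector_derivative_def]]
  by (simp add: has_vector_derivative_def)

lemma has_vector_derivative_fst:
  "(f has_vector_derivative f') F \<Longrightarrow> ((\<lambda>t. fst (f t)) has_vector_derivative fst f') F"
  by (rule bounded_linear.has_vector_derivative[OF bounded_linear_fst])

lemma has_vector_derivative_snd:
  "(f has_vector_derivative f') F \<Longrightarrow> ((\<lambda>t. snd (f t)) has_vector_derivative snd f') F"
  by (rule bounded_linear.has_vector_derivative[OF bounded_linear_snd])

text \<open>The shift \<open>c\<close> allows an arc to begin at a later switching time of a
  trajectory.\<close>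

lemma arc_solves: "solves_fuller u S (\<lambda>t. fuller_arc u z (t - c))"
proof -
  obtain z1 z2 z3 where z: "z = (z1, z2, z3)" by (cases z)
  let ?c = "complex_of_real c"
  have "((\<lambda>x. z1 - \<i> * u * (x - ?c)) has_field_derivative - \<i> * u) (at x)"
    and "((\<lambda>x. z2 + z1 * (x - ?c) - \<i> * u * (x - ?c) ^ 2 / 2)
          has_field_derivative z1 - \<i> * u * (x - ?c)) (at x)"
    and "((\<lambda>x. z3 + z2 * (x - ?c) + z1 * (x - ?c) ^ 2 / 2 - \<i> * u * (x - ?c) ^ 3 / 6)
          has_field_derivative z2 + z1 * (x - ?c) - \<i> * u * (x - ?c) ^ 2 / 2) (at x)" for x
    by (auto intro!: derivative_eq_intros simp: power2_eq_square field_simps)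
  note d = this[THEN has_vector_derivative_real_field]
  from has_vector_derivative_Pair[OF d(1) has_vector_derivative_Pair[OF d(2,3)]]
  show ?thesis by (simp add: solves_fuller_def z fuller_arc_def fuller_field_def)
qed

lemma same_vector_derivative_imp_eq:
  fixes f g :: "real \<Rightarrow> 'a :: real_normed_vector"
  assumes "\<And>t. (f has_vector_derivative d t) (at t)" "\<And>t. (g has_vector_derivative d t) (at t)"
    and "f 0 = g 0"
  shows "f = g"
proof -
  have "((\<lambda>t. f t - g t) has_derivative (\<lambda>h. 0)) (at t)" for t
    using has_vector_derivative_diff[OF assms(1,2), of t] by (simp add: has_vector_derivative_def)
  then obtain c where "f t - g t = c" for t
    using has_derivative_zero_constant[OF convex_UNIV] by (metis UNIV_I)
  with this[of 0] assms(3) show ?thesis by (simp add: fun_eq_iff)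
qed

text \<open>The field is triangular: the first derivative is constant and each further one is the
  preceding coordinate. Hence uniqueness follows one coordinate at a time, from functions with equal
  derivatives and equal values at 0.\<close>

lemma flow_eq: "flow u z0 = fuller_arc u z0"
  unfolding flow_def
proof (rule the_equality)
  show "fuller_arc u z0 0 = z0 \<and> solves_fuller u UNIV (fuller_arc u z0)"
    using arc_solves[of u UNIV z0 0] by simp
next
  fix z assume z: "z 0 = z0 \<and> solves_fuller u UNIV z"
  let ?a = "fuller_arc u z0"
  have dz: "(z has_vector_derivative fuller_field u (z t)) (at t)" for t
    using z by (simp add: solves_fuller_def)
  have da: "(?a has_vector_derivative fuller_field u (?a t)) (at t)" for t
    using arc_solves[of u UNIV z0 0] by (simp add: solves_fuller_def)
  have field: "fst (fuller_field u x) = - \<i> * u" "fst (snd (fuller_field u x)) = fst x"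
    "snd (snd (fuller_field u x)) = fst (snd x)" for x
    by (cases x; simp add: fuller_field_def)+
  note d1 = has_vector_derivative_fst and d2 = has_vector_derivative_fst[OF has_vector_derivative_snd]
    and d3 = has_vector_derivative_snd[OF has_vector_derivative_snd]
  have c1: "(\<lambda>t. fst (z t)) = (\<lambda>t. fst (?a t))"
    by (rule same_vector_derivative_imp_eq[OF d1[OF dz, unfolded field] d1[OF da, unfolded field]])
      (simp add: z)
  have c2: "(\<lambda>t. fst (snd (z t))) = (\<lambda>t. fst (snd (?a t)))"
    by (rule same_vector_derivative_imp_eq[OF d2[OF dz, unfolded field fun_cong[OF c1]] d2[OF da, unfolded field]])
      (simp add: z)
  have c3: "(\<lambda>t. snd (snd (z t))) = (\<lambda>t. snd (snd (?a t)))"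
    by (rule same_vector_derivative_imp_eq[OF d3[OF dz, unfolded field fun_cong[OF c2]] d3[OF da, unfolded field]])
      (simp add: z)
  show "z = ?a"
    by (rule ext, rule prod_eqI[OF fun_cong[OF c1] prod_eqI[OF fun_cong[OF c2] fun_cong[OF c3]]])
qed

text \<open>The advantage of \<open>u\<close> over \<open>v\<close> in the Hamiltonian, along the
  arc with control \<open>u\<close>; its positive zeros are the candidates for switching
  times.\<close>

definition gap :: "complex \<Rightarrow> complex \<Rightarrow> state \<Rightarrow> real \<Rightarrow> real" where
  "gap u v z t = Re_pair (u - v) (comp3 (fuller_arc u z t))"

lemma gap_cubic:
  "gap u v z t = Re_pair (u - v) (comp3 z) + Re_pair (u - v) (comp2 z) * t
     + Re_pair (u - v) (comp1 z) / 2 * t ^ 2 + Re_pair (u - v) (- \<i> * u) / 6 * t ^ 3"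
  by (cases z) (simp add: gap_def fuller_arc_def Re_pair_def field_simps flip: of_real_power)

text \<open>The two signs have separate uses. The positive one settles a tie in favour of
  \<open>u\<close> against \<open>zeta * u\<close>; the negative one makes the gap to
  \<open>zeta\<^sup>2 * u\<close> eventually negative, so that a switch must come.\<close>

lemma gap_lead:
  assumes "u \<in> V_T"
  shows "Re_pair (u - zeta * u) (- \<i> * u) = sqrt 3 / 2"
    and "Re_pair (u - zeta\<^sup>2 * u) (- \<i> * u) = - sqrt 3 / 2"
proof -
  have *: "Re_pair (u - x * u) (- \<i> * u) = Im x" for x
  proof -
    have "cnj (u - x * u) * (- \<i> * u) = cnj u * u * (cnj (1 - x) * (- \<i>))"
      by (simp add: algebra_simps)
    then show ?thesis unfolding Re_pair_def by (simp only: V_T_cnj_mult(1)[OF assms]) simp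
  qed
  show "Re_pair (u - zeta * u) (- \<i> * u) = sqrt 3 / 2"
    and "Re_pair (u - zeta\<^sup>2 * u) (- \<i> * u) = - sqrt 3 / 2"
    unfolding * by simp_all
qed

text \<open>A certificate for both descriptions in the switching rule: positive gaps just after time
  0 identify the first control, and positivity up to a zero at \<open>T\<close> makes
  \<open>T\<close> the least switching time.\<close>

definition switches :: "state \<Rightarrow> complex \<Rightarrow> real \<Rightarrow> bool" where
  "switches z u T \<longleftrightarrow> u \<in> V_T \<and> T > 0 \<and> (\<forall>v\<in>V_T - {u}. \<forall>t\<in>{0<..<T}. gap u v z t > 0)
     \<and> (\<exists>v\<in>V_T - {u}. gap u v z T = 0)"

lemma continuous_gap [continuous_intros]: "continuous_on S (gap u v z)"
  unfolding gap_cubic[abs_def] by (intro continuous_intros)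

lemma gap_nonneg:
  assumes "switches z u T" "v \<in> V_T" "0 \<le> t" "t \<le> T"
  shows "gap u v z t \<ge> 0"
proof (cases "v = u")
  case False
  have "closure {0<..<T} = {0..T}" using assms(1) by (auto simp: switches_def)
  moreover have "gap u v z x \<ge> 0" if "x \<in> closure {0<..<T}" for x
    using continuous_gap by (rule continuous_ge_on_closure[OF _ that])
      (use assms False in \<open>auto simp: switches_def intro: less_imp_le\<close>)
  ultimately show ?thesis using assms by auto
qed (simp add: gap_def Re_pair_def)

text \<open>Whether a cubic is positive just to the right of 0 is decided by the lexicographic sign of
  its coefficients; this turns the lexicographic rule for the first control into a statement
  about positive times.\<close>

lemma eventually_cubic_pos:
  fixes a b c d :: real
  assumes "a > 0 \<or> a = 0 \<and> (b > 0 \<or> b = 0 \<and> (c > 0 \<or> c = 0 \<and> d > 0))"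
  shows "eventually (\<lambda>t. a + b * t + c * t ^ 2 + d * t ^ 3 > 0) (at_right 0)"
proof -
  \<comment> \<open>In Horner form one coefficient is peeled off at a time: a positive constant term
    wins by continuity, and a zero one leaves the factor \<open>t > 0\<close>, which does not change
    the sign.\<close>
  have step: "eventually (\<lambda>t. a + t * f t > 0) (at_right 0)"
    if "a > 0 \<or> a = 0 \<and> eventually (\<lambda>t. f t > 0) (at_right 0)" "continuous_on UNIV f"
    for a :: real and f
  proof (cases "a > 0")
    case True
    have "((\<lambda>t. a + t * f t) \<longlongrightarrow> a + 0 * f 0) (at_right 0)"
      using that(2) by (intro tendsto_intros) (auto simp: continuous_on_def intro: tendsto_within_subset)
    then show ?thesis using order_tendstoD(1) True by fastforce
  next
    case False
    then have "a = 0" "eventually (\<lambda>t. f t > 0) (at_right 0)" using that(1) by auto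
    from this(2) eventually_at_right_less[of "0::real"] show ?thesis
      by eventually_elim (simp add: \<open>a = 0\<close>)
  qed
  have "eventually (\<lambda>t. a + t * (b + t * (c + t * d)) > 0) (at_right 0)"
  proof (rule step)
    have "eventually (\<lambda>t. c + t * d > 0) (at_right 0)" if "c > 0 \<or> c = 0 \<and> d > 0"
      by (rule step[of c "\<lambda>_. d"]) (use that in auto)
    then have "eventually (\<lambda>t. b + t * (c + t * d) > 0) (at_right 0)"
      if "b > 0 \<or> b = 0 \<and> (c > 0 \<or> c = 0 \<and> d > 0)"
      by (intro step) (use that in \<open>auto intro!: continuous_intros\<close>)
    then show "0 < a \<or> a = 0 \<and> eventually (\<lambda>t. b + t * (c + t * d) > 0) (at_right 0)"
      using assms by blast
  qed (intro continuous_intros)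
  then show ?thesis by (simp add: algebra_simps power2_eq_square power3_eq_cube)
qed

text \<open>If the lexicographic sign is not positive, either all coefficients vanish or the negated
  cubic is eventually positive; both contradict the assumption.\<close>

lemma lex_of_eventually_cubic_pos:
  fixes a b c d :: real
  assumes ev: "eventually (\<lambda>t. a + b * t + c * t ^ 2 + d * t ^ 3 > 0) (at_right 0)"
  shows "a > 0 \<or> a = 0 \<and> (b > 0 \<or> b = 0 \<and> (c > 0 \<or> c = 0 \<and> d > 0))"
proof (rule ccontr)
  assume neg: "\<not> ?thesis"
  show False
  proof (cases "a = 0 \<and> b = 0 \<and> c = 0 \<and> d = 0")
    case True
    then show False using ev by simp
  next
    case False
    then have "eventually (\<lambda>t. - a + - b * t + - c * t ^ 2 + - d * t ^ 3 > 0) (at_right 0)"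
      using neg by (intro eventually_cubic_pos)
        (cases a "0::real" rule: linorder_cases; cases b "0::real" rule: linorder_cases;
         cases c "0::real" rule: linorder_cases; simp)
    with ev have "eventually (\<lambda>t. False) (at_right (0::real))"
      by eventually_elim simp
    then show False by simp
  qed
qed

lemma Re_pair_diff_left: "Re_pair (u - v) x = Re_pair x u - Re_pair x v"
  by (simp add: Re_pair_def algebra_simps)

text \<open>The tie-break \<open>v = zeta * u\<close> is right because then the cubic term decides, and it is
  positive exactly for this order of the two controls.\<close>

lemma lex_maximal_iff_eventually:
  assumes "u \<in> V_T"
  shows "(lex_maximal z u \<and> (\<forall>v. lex_maximal z v \<longrightarrow> v = u \<or> v = zeta * u)) \<longleftrightarrow>
    (\<forall>v\<in>V_T - {u}. eventually (\<lambda>t. gap u v z t > 0) (at_right 0))" (is "?L \<longleftrightarrow> ?R")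
proof -
  let ?A = "\<lambda>v. Re_pair (u - v) (comp3 z)" and ?B = "\<lambda>v. Re_pair (u - v) (comp2 z)"
    and ?C = "\<lambda>v. Re_pair (u - v) (comp1 z)"
  have ev: "eventually (\<lambda>t. gap u v z t > 0) (at_right 0) \<longleftrightarrow>
     ?A v > 0 \<or> ?A v = 0 \<and> (?B v > 0 \<or> ?B v = 0 \<and> (?C v > 0 \<or> ?C v = 0 \<and> Re_pair (u - v) (- \<i> * u) > 0))" for v
    using eventually_cubic_pos[of "?A v" "?B v" "?C v / 2" "Re_pair (u - v) (- \<i> * u) / 6"]
      lex_of_eventually_cubic_pos[of "?A v" "?B v" "?C v / 2" "Re_pair (u - v) (- \<i> * u) / 6"]
    unfolding gap_cubic zero_less_divide_iff divide_eq_0_iff by auto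
  have le: "lex_le (control_vector z v) (control_vector z u) \<longleftrightarrow>
     ?A v > 0 \<or> ?A v = 0 \<and> (?B v > 0 \<or> ?B v = 0 \<and> ?C v \<ge> 0)" for v
    by (auto simp: lex_le_def control_vector_def Re_pair_diff_left)
  have le': "lex_le (control_vector z u) (control_vector z v) \<longleftrightarrow>
     ?A v < 0 \<or> ?A v = 0 \<and> (?B v < 0 \<or> ?B v = 0 \<and> ?C v \<le> 0)" for v
    by (auto simp: lex_le_def control_vector_def Re_pair_diff_left)
  have trans: "lex_le p q \<Longrightarrow> lex_le q s \<Longrightarrow> lex_le p s" for p q s
    by (auto simp: lex_le_def)
  show ?thesis
  proof
    assume L: ?L
    show ?R
    proof
      fix v assume v: "v \<in> V_T - {u}"
      have lev: "lex_le (control_vector z v) (control_vector z u)"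
        using L v by (auto simp: lex_maximal_def)
      show "eventually (\<lambda>t. gap u v z t > 0) (at_right 0)"
      proof (cases "lex_le (control_vector z u) (control_vector z v)")
        case True
        then have "lex_maximal z v"
          using L v unfolding lex_maximal_def by (blast intro: trans)
        then have "v = zeta * u" using L v by auto
        then have "Re_pair (u - v) (- \<i> * u) = sqrt 3 / 2" using gap_lead(1)[OF assms] by (simp only:)
        moreover have "sqrt 3 / 2 > (0::real)" by simp
        ultimately have "Re_pair (u - v) (- \<i> * u) > 0" by (simp only:)
        then show ?thesis using lev unfolding ev le by auto
      next
        case False
        then show ?thesis using lev unfolding ev le le' by auto
      qed
    qed
  next
    assume R: ?R
    have max: "lex_maximal z u"
      unfolding lex_maximal_def
    proof (intro conjI ballI)
      fix v assume "v \<in> V_T"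
      then show "lex_le (control_vector z v) (control_vector z u)"
        using R unfolding ev le by (cases "v = u") (auto simp: Re_pair_def)
    qed (rule assms)
    moreover have "v = u \<or> v = zeta * u" if "lex_maximal z v" for v
    proof (rule ccontr)
      assume "\<not> ?thesis"
      moreover have "v \<in> V_T" using that by (simp add: lex_maximal_def)
      ultimately have v: "v \<in> V_T - {u}" "v = zeta\<^sup>2 * u" using V_T_others[OF assms] by auto
      then have "Re_pair (u - v) (- \<i> * u) = - sqrt 3 / 2" using gap_lead(2)[OF assms] by (simp only:)
      moreover have "- sqrt 3 / 2 < (0::real)" by simp
      ultimately have "Re_pair (u - v) (- \<i> * u) < 0" by (simp only:)
      moreover have "lex_le (control_vector z u) (control_vector z v)"
        using that assms by (simp add: lex_maximal_def)
      ultimately show False using R v(1) unfolding ev le' by force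
    qed
    ultimately show ?L by blast
  qed
qed

lemma switches_eventually:
  assumes "switches z u T" "v \<in> V_T - {u}"
  shows "eventually (\<lambda>t. gap u v z t > 0) (at_right 0)"
  using assms unfolding switches_def by (auto simp: eventually_at_right_field intro!: exI[of _ T])

text \<open>The tie-break is unambiguous: two distinct candidates would each be \<open>zeta\<close>
  times the other, which forces \<open>zeta\<^sup>2 = 1\<close>.\<close>

lemma switches_first_control:
  assumes "switches z u T"
  shows "first_control z = u"
  unfolding first_control_def
proof (rule the_equality)
  have "u \<in> V_T" using assms by (simp add: switches_def)
  then show u: "lex_maximal z u \<and> (\<forall>v. lex_maximal z v \<longrightarrow> v = u \<or> v = zeta * u)"
    using lex_maximal_iff_eventually switches_eventually[OF assms] by blast
  fix v assume v: "lex_maximal z v \<and> (\<forall>w. lex_maximal z w \<longrightarrow> w = v \<or> w = zeta * v)"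
  show "v = u"
  proof (rule ccontr)
    assume "v \<noteq> u"
    then have "v = zeta * u" "u = zeta * v" using u v by auto
    then have "u = zeta\<^sup>2 * u" by (metis mult.assoc power2_eq_square)
    then show False using V_T_all_distinct(2)[OF \<open>u \<in> V_T\<close>] by simp
  qed
qed

lemma switches_t_sw:
  assumes "switches z u T"
  shows "t_sw z = T"
  unfolding t_sw_def Let_def switches_first_control[OF assms] flow_eq gap_def[symmetric]
proof (rule Least_equality)
  show "T > 0 \<and> (\<exists>v\<in>V_T - {u}. gap u v z T = 0)" using assms by (auto simp: switches_def)
  fix t assume "t > 0 \<and> (\<exists>v\<in>V_T - {u}. gap u v z t = 0)"
  then show "T \<le> t" using assms unfolding switches_def 
    by (metis greaterThanLessThan_iff less_irrefl not_le)
qed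

lemma switches_fuller_map: "switches z u T \<Longrightarrow> fuller_map z = fuller_arc u z T"
  by (simp add: fuller_map_def flow_eq switches_first_control switches_t_sw)

text \<open>A total order on three elements has a maximum. All three cannot tie, since a complex
  number with equal pairings against the three cube roots of unity is 0, and \<open>z\<close> would
  vanish.\<close>

lemma lex_maximal_exists:
  assumes "z \<noteq> 0"
  shows "\<exists>u\<in>V_T. lex_maximal z u \<and> (\<forall>v. lex_maximal z v \<longrightarrow> v = u \<or> v = zeta * u)"
proof -
  have total: "lex_le p q \<or> lex_le q p" and trans: "lex_le p q \<Longrightarrow> lex_le q s \<Longrightarrow> lex_le p s" for p q s
    by (auto simp: lex_le_def)
  have antisym: "p = q" if "lex_le p q" "lex_le q p" for p q
    using that by (auto simp: lex_le_def)
  let ?c = "control_vector z"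
  have max: "lex_maximal z u \<longleftrightarrow> u \<in> V_T \<and> lex_le (?c 1) (?c u) \<and> lex_le (?c zeta) (?c u) \<and> lex_le (?c (zeta\<^sup>2)) (?c u)" for u
    by (auto simp: lex_maximal_def V_T_def)
  let ?le = "\<lambda>u v. lex_le (?c u) (?c v)"
  have refl: "?le u u" for u using total by blast
  have "lex_maximal z 1 \<or> lex_maximal z zeta \<or> lex_maximal z (zeta\<^sup>2)"
  proof (cases "?le 1 zeta")
    case True
    show ?thesis
    proof (cases "?le zeta (zeta\<^sup>2)")
      case True
      then have "lex_maximal z (zeta\<^sup>2)"
        unfolding max using trans[OF \<open>?le 1 zeta\<close> True] refl by (intro conjI) simp_all
      then show ?thesis by blast
    next
      case False
      then have "?le (zeta\<^sup>2) zeta" using total by blast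
      then have "lex_maximal z zeta"
        unfolding max using \<open>?le 1 zeta\<close> refl by (intro conjI) simp_all
      then show ?thesis by blast
    qed
  next
    case False
    then have z1: "?le zeta 1" using total by blast
    show ?thesis
    proof (cases "?le 1 (zeta\<^sup>2)")
      case True
      then have "lex_maximal z (zeta\<^sup>2)"
        unfolding max using trans[OF z1 True] refl by (intro conjI) simp_all
      then show ?thesis by blast
    next
      case False
      then have "?le (zeta\<^sup>2) 1" using total by blast
      then have "lex_maximal z 1"
        unfolding max using z1 refl by (intro conjI) simp_all
      then show ?thesis by blast
    qed
  qed
  moreover have "\<not> (lex_maximal z 1 \<and> lex_maximal z zeta \<and> lex_maximal z (zeta\<^sup>2))"
  proof
    assume "lex_maximal z 1 \<and> lex_maximal z zeta \<and> lex_maximal z (zeta\<^sup>2)"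
    then have "?c 1 = ?c zeta" "?c zeta = ?c (zeta\<^sup>2)"
      unfolding max by (blast intro: antisym)+
    then have eq: "Re_pair x 1 = Re_pair x zeta \<and> Re_pair x zeta = Re_pair x (zeta\<^sup>2)"
      if "x \<in> {comp1 z, comp2 z, comp3 z}" for x
      using that by (auto simp: control_vector_def)
    have "x = 0" if "x \<in> {comp1 z, comp2 z, comp3 z}" for x
      using eq[OF that] by (auto simp: Re_pair_def complex_eq_iff)
    then show False using assms by (cases z) (simp add: zero_prod_def)
  qed
  moreover have V: "lex_maximal z v \<Longrightarrow> v = 1 \<or> v = zeta \<or> v = zeta\<^sup>2" for v
    by (auto simp: lex_maximal_def V_T_def)
  \<comment> \<open>Going round the cycle \<open>1\<close>, \<open>zeta\<close>,
    \<open>zeta\<^sup>2\<close>, some maximal element follows a non-maximal one; that element is the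
    right choice.\<close>
  ultimately consider "lex_maximal z 1" "\<not> lex_maximal z (zeta\<^sup>2)"
    | "lex_maximal z zeta" "\<not> lex_maximal z 1" | "lex_maximal z (zeta\<^sup>2)" "\<not> lex_maximal z zeta"
    by blast
  then show ?thesis
  proof cases
    case 1
    then show ?thesis using V by (intro bexI[of _ 1]) auto
  next
    case 2
    then show ?thesis using V by (intro bexI[of _ zeta]) (auto simp: zeta_mult)
  next
    case 3
    then show ?thesis using V by (intro bexI[of _ "zeta\<^sup>2"]) (auto simp: zeta_mult)
  qed
qed

text \<open>The gaps are nonzero cubic polynomials, so they have finitely many zeros. At least one
  positive zero exists, because the gap to \<open>zeta\<^sup>2 * u\<close> starts positive and
  becomes negative. The least zero is the switching time.\<close>

lemma switches_exists:
  assumes "z \<noteq> 0"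
  shows "\<exists>u T. switches z u T"
proof -
  obtain u where u: "u \<in> V_T" and ev: "\<And>v. v \<in> V_T - {u} \<Longrightarrow> eventually (\<lambda>t. gap u v z t > 0) (at_right 0)"
    using lex_maximal_exists[OF assms] lex_maximal_iff_eventually by blast
  define p where "p v = [:Re_pair (u - v) (comp3 z), Re_pair (u - v) (comp2 z),
     Re_pair (u - v) (comp1 z) / 2, Re_pair (u - v) (- \<i> * u) / 6:]" for v
  have p: "gap u v z t = poly (p v) t" for v t
    by (simp add: gap_cubic p_def algebra_simps power2_eq_square power3_eq_cube)
  have p0: "p v \<noteq> 0" if "v \<in> V_T - {u}" for v
    using that gap_lead[OF u] unfolding V_T_others[OF u] by (auto simp: p_def)
  define Z where "Z = {t. t > 0 \<and> (\<exists>v\<in>V_T - {u}. gap u v z t = 0)}"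
  have "Z \<subseteq> (\<Union>v\<in>V_T - {u}. {t. poly (p v) t = 0})" by (auto simp: Z_def p)
  then have fin: "finite Z" by (rule finite_subset) (auto intro!: poly_roots_finite p0)
  define w where "w = zeta\<^sup>2 * u"
  have w: "w \<in> V_T - {u}" unfolding V_T_others[OF u] w_def by simp
  have lead: "lead_coeff (- p w) > 0" using gap_lead(2)[OF u] by (simp add: w_def p_def)
  obtain n where n: "\<And>t. t \<ge> n \<Longrightarrow> lead_coeff (- p w) \<le> poly (- p w) t"
    using poly_pinfty_gt_lc[OF lead] by blast
  obtain b where b: "b > 0" "\<And>t. 0 < t \<Longrightarrow> t < b \<Longrightarrow> gap u w z t > 0"
    using ev[OF w] by (auto simp: eventually_at_right_field)
  have "\<exists>t\<ge>b/2. t \<le> max b n \<and> gap u w z t = 0"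
  proof (rule IVT2')
    show "gap u w z (max b n) \<le> 0" using n[of "max b n"] lead by (simp add: p)
    show "0 \<le> gap u w z (b / 2)" using b(2)[of "b/2"] b(1) by simp
  qed (use b in \<open>auto intro: continuous_gap\<close>)
  then have "Z \<noteq> {}" using b(1) w by (force simp: Z_def)
  define T where "T = Min Z"
  have T: "T \<in> Z" "\<And>t. t \<in> Z \<Longrightarrow> T \<le> t" using fin \<open>Z \<noteq> {}\<close> by (auto simp: T_def)
  have "gap u v z t > 0" if v: "v \<in> V_T - {u}" and t: "0 < t" "t < T" for v t
  proof (rule ccontr)
    assume neg: "\<not> gap u v z t > 0"
    obtain b where b: "b > 0" "\<And>t. 0 < t \<Longrightarrow> t < b \<Longrightarrow> gap u v z t > 0"
      using ev[OF v] by (auto simp: eventually_at_right_field)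
    \<comment> \<open>A time not after \<open>t\<close> at which the gap is still positive; a change
      of sign from there to \<open>t\<close> would give a zero before the least one.\<close>
    define a where "a = min t b / 2"
    have a: "0 < a" "a < b" "a \<le> t" using b(1) t by (auto simp: a_def)
    have "\<exists>x\<ge>a. x \<le> t \<and> gap u v z x = 0"
      by (rule IVT2') (use neg b(2)[of a] a in \<open>auto intro: continuous_gap\<close>)
    then obtain x where "x \<ge> a" "x \<le> t" "gap u v z x = 0" by blast
    then have "x \<in> Z" using v a by (auto simp: Z_def)
    then show False using T(2)[of x] \<open>x \<le> t\<close> t by simp
  qed
  then have "switches z u T" using T(1) u by (auto simp: switches_def Z_def)
  then show ?thesis by blast
qed

section \<open>Equivariance under the virial group\<close>

lemma virial_Pair: "virial (w, r) (z1, z2, z3)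
   = (w * of_real r * z1, w * of_real (r ^ 2) * z2, w * of_real (r ^ 3) * z3)"
  by (simp add: virial_def)

lemma virial_virial: "virial (w, r) (virial (v, s) z) = virial (w * v, r * s) z"
  by (cases z) (simp add: virial_def power_mult_distrib ac_simps)

lemma virial_1 [simp]: "virial (1, 1) z = z"
  by (cases z) (simp add: virial_def)

lemma arc_virial: "fuller_arc (w * u) (virial (w, r) z) (r * t) = virial (w, r) (fuller_arc u z t)"
  by (cases z) (simp add: virial_def fuller_arc_def algebra_simps power2_eq_square power3_eq_cube add_divide_distrib)

lemma gap_virial:
  assumes "w \<in> V_T"
  shows "gap (w * u) (w * v) (virial (w, r) z) (r * t) = r ^ 3 * gap u v z t"
proof -
  obtain y1 y2 y3 where y: "fuller_arc u z t = (y1, y2, y3)" by (cases "fuller_arc u z t")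
  have "cnj (w * u - w * v) * (w * of_real (r ^ 3) * y3) = cnj w * w * (of_real (r ^ 3) * (cnj (u - v) * y3))"
    by (simp add: algebra_simps)
  then have "cnj (w * u - w * v) * (w * of_real (r ^ 3) * y3) = of_real (r ^ 3) * (cnj (u - v) * y3)"
    using V_T_cnj_mult(1)[OF assms] by simp
  then show ?thesis
    by (simp only: gap_def arc_virial y virial_Pair comp_simps Re_pair_def) simp
qed

text \<open>Multiplication by \<open>w\<close> permutes the controls, while the dilation stretches
  time by \<open>r\<close> and multiplies every gap by the positive number
  \<open>r ^ 3\<close>.\<close>

lemma switches_virial:
  assumes sw: "switches z u T" and w: "w \<in> V_T" and r: "r > 0"
  shows "switches (virial (w, r) z) (w * u) (r * T)"
proof -
  have w0: "w \<noteq> 0" using V_T_norm[OF w] by auto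
  have V: "V_T - {w * u} = (*) w ` (V_T - {u})"
  proof -
    have "(*) w ` V_T = V_T"
    proof
      show "(*) w ` V_T \<subseteq> V_T" using V_T_mult[OF w] by auto
      show "V_T \<subseteq> (*) w ` V_T"
      proof
        fix v assume "v \<in> V_T"
        then have "v = w * (cnj w * v)" "cnj w * v \<in> V_T"
          using V_T_cnj_mult(2)[OF w] V_T_mult V_T_cnj[OF w] by (auto simp flip: mult.assoc)
        then show "v \<in> (*) w ` V_T" by blast
      qed
    qed
    moreover have "inj ((*) w)" using w0 by (auto simp: inj_def)
    ultimately show ?thesis by (simp add: image_set_diff)
  qed
  have "gap (w * u) (w * v) (virial (w, r) z) t > 0" if "v \<in> V_T - {u}" "t \<in> {0<..<r * T}" for v t
  proof -
    have "gap (w * u) (w * v) (virial (w, r) z) t = r ^ 3 * gap u v z (t / r)"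
      using gap_virial[OF w, of u v r z "t / r"] r by simp
    moreover have "t / r \<in> {0<..<T}" using that(2) r by (simp add: field_simps)
    ultimately show ?thesis using sw that(1) r by (simp add: switches_def)
  qed
  moreover have "\<exists>v\<in>V_T - {u}. gap (w * u) (w * v) (virial (w, r) z) (r * T) = 0"
    using sw by (auto simp: switches_def gap_virial[OF w])
  ultimately show ?thesis
    using sw V_T_mult[OF w] mult_pos_pos[OF r] unfolding switches_def V by blast
qed

section \<open>Coordinates of the spiral points\<close>

text \<open>The coordinates of the switching points, in units that absorb the irrationality:
  \<open>Im z1 = sqrt 3 * spB r\<close>, \<open>Re z2 = sqrt 3 * spC r\<close>, and the switching time is \<open>sqrt 3 * spT r\<close>.
  The form \<open>spE\<close> of the third coordinate, shorter than the one in \<open>q_rep\<close>, is the value forced by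
  the vanishing of the Hamiltonian; both agree at the roots of \<open>spiral_poly\<close>.\<close>

definition spB :: "real \<Rightarrow> real" where "spB r = (r - 1) / (3 * (1 + r))"
definition spC :: "real \<Rightarrow> real" where "spC r = - ((- 1 + r ^ 3) / (3 * (1 + r ^ 3)))"
definition spD :: "real \<Rightarrow> real" where
  "spD r = (1 - 3 * r - 2 * r ^ 2 - 3 * r ^ 3 + r ^ 4) / (3 * (1 + r) * (1 + r ^ 3))"
definition spE :: "real \<Rightarrow> real" where
  "spE r = - 4 * r * (1 + r + r ^ 2) / (3 * (1 + r) * (1 + r ^ 3))"
definition spT :: "real \<Rightarrow> real" where "spT r = 2 * (1 + r + r ^ 2) / (3 * (1 + r))"

lemma spiral_denominators:
  fixes r :: real
  assumes "r > 0"
  shows "1 + r > 0" "1 + r ^ 3 > 0" "1 - r + r\<^sup>2 > 0" "1 + r ^ 3 = (1 + r) * (1 - r + r\<^sup>2)"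
proof -
  show "1 + r > 0" "1 + r ^ 3 > 0" using assms by (simp_all add: add_pos_pos)
  show "1 + r ^ 3 = (1 + r) * (1 - r + r\<^sup>2)" by algebra
  with \<open>1 + r > 0\<close> \<open>1 + r ^ 3 > 0\<close> show "1 - r + r\<^sup>2 > 0" by (simp add: zero_less_mult_iff)
qed

text \<open>Cleared of denominators, the definitions become polynomial relations, from which the
  identities below follow by elimination.\<close>

lemma sp_mult:
  assumes "r > 0"
  shows "3 * (1 + r) * spB r = r - 1" "3 * (1 + r ^ 3) * spC r = 1 - r ^ 3"
    "3 * (1 + r) * (1 + r ^ 3) * spD r = 1 - 3 * r - 2 * r ^ 2 - 3 * r ^ 3 + r ^ 4"
    "3 * (1 + r) * (1 + r ^ 3) * spE r = - 4 * r * (1 + r + r ^ 2)"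
    "3 * (1 + r) * spT r = 2 * (1 + r + r ^ 2)"
  using spiral_denominators(1,2)[OF assms]
  by (simp_all add: spB_def spC_def spD_def spE_def spT_def)

lemma spT_pos: "r > 0 \<Longrightarrow> spT r > 0"
  by (simp add: spT_def add_pos_pos)

lemma spE_neg: "r > 0 \<Longrightarrow> spE r < 0"
  by (simp add: spE_def add_pos_pos divide_neg_pos mult_pos_pos)

text \<open>The first four are the real and imaginary parts of the spiral equation in the
  coordinates 1 and 2, with \<open>Re z1 = - 1\<close>; the fifth is the vanishing of the
  Hamiltonian. They hold for every positive \<open>r\<close>: only the third coordinate restricts
  the ratio.\<close>

lemma sp_eqs:
  assumes r: "r > 0"
  shows "3 * spT r - 2 = r * (3 * spB r + 1)"
    and "2 * spB r + spT r = r * (1 - spB r)"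
    and "4 * spC r - 4 * spT r + 3 * spT r ^ 2 = 2 * r ^ 2 * (spD r - spC r)"
    and "4 * spD r + 12 * spB r * spT r + 3 * spT r ^ 2 = - 2 * r ^ 2 * (3 * spC r + spD r)"
    and "2 * spD r + 6 * spB r * spC r = spE r"
proof -
  note m = sp_mult[OF r] and d = spiral_denominators[OF r]
  have nz: "1 + r \<noteq> 0" "(1 + r)\<^sup>2 * (1 + r ^ 3) \<noteq> 0" using d by auto
  have "(1 + r) * (3 * spT r - 2 - r * (3 * spB r + 1)) = 0"
    using m(1,5) by algebra
  then show "3 * spT r - 2 = r * (3 * spB r + 1)" using nz by simp
  have "(1 + r) * (2 * spB r + spT r - r * (1 - spB r)) = 0"
    using m(1,5) by algebra
  then show "2 * spB r + spT r = r * (1 - spB r)" using nz by simp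
  have "(1 + r)\<^sup>2 * (1 + r ^ 3) * (4 * spC r - 4 * spT r + 3 * spT r ^ 2 - 2 * r ^ 2 * (spD r - spC r)) = 0"
    using m(2,3,5) d(4) by algebra
  then show "4 * spC r - 4 * spT r + 3 * spT r ^ 2 = 2 * r ^ 2 * (spD r - spC r)" using nz by simp
  have "(1 + r)\<^sup>2 * (1 + r ^ 3) * (4 * spD r + 12 * spB r * spT r + 3 * spT r ^ 2 - (- 2 * r ^ 2 * (3 * spC r + spD r))) = 0"
    using m(1,2,3,5) d(4) by algebra
  then show "4 * spD r + 12 * spB r * spT r + 3 * spT r ^ 2 = - 2 * r ^ 2 * (3 * spC r + spD r)" using nz by simp
  have "(1 + r)\<^sup>2 * (1 + r ^ 3) * (2 * spD r + 6 * spB r * spC r - spE r) = 0"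
    using m(1,2,3,4) d(4) by algebra
  then show "2 * spD r + 6 * spB r * spC r = spE r" using nz by simp
qed

text \<open>The real part of the spiral equation in coordinate 3. Without denominators it is
  \<open>8 * (1 + r + r ^ 2)\<close> times the sextic.\<close>

lemma sp_switch_real:
  assumes r: "r > 0" "poly spiral_poly r = 0"
  shows "4 * spE r + 12 * spC r * spT r - 6 * spT r ^ 2 + 3 * spT r ^ 3 = - 2 * r ^ 3 * spE r"
proof -
  note m = sp_mult[OF r(1)] and d = spiral_denominators[OF r(1)]
  let ?s = "1 + r + r ^ 2" and ?c = "9 * (1 + r) ^ 3 * (1 - r + r\<^sup>2)"
  have e: "?c * spE r = 3 * (1 + r) * (- 4 * r * ?s)"
    "?c * (12 * spC r * spT r) = 12 * (1 + r) * (1 - r ^ 3) * (2 * ?s)"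
    "?c * (6 * spT r ^ 2) = 24 * (1 + r) * (1 - r + r\<^sup>2) * ?s ^ 2"
    "?c * (3 * spT r ^ 3) = 8 * (1 - r + r\<^sup>2) * ?s ^ 3"
    using m(2,4,5) d(4) by algebra+
  have split: "c * (4 * e + x - y + z + 2 * k * e) = 4 * (c * e) + c * x - c * y + c * z + 2 * k * (c * e)"
    for c e x y z k :: real by algebra
  have "4 * (3 * (1 + r) * (- 4 * r * ?s)) + 12 * (1 + r) * (1 - r ^ 3) * (2 * ?s)
      - 24 * (1 + r) * (1 - r + r\<^sup>2) * ?s ^ 2 + 8 * (1 - r + r\<^sup>2) * ?s ^ 3
      + 2 * r ^ 3 * (3 * (1 + r) * (- 4 * r * ?s)) = 8 * ?s * poly spiral_poly r"
    unfolding spiral_poly_eval by algebra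
  then have "?c * (4 * spE r + 12 * spC r * spT r - 6 * spT r ^ 2 + 3 * spT r ^ 3 + 2 * r ^ 3 * spE r) = 0"
    unfolding split e r(2) by simp
  then show ?thesis using d(1,3) by simp
qed

text \<open>The imaginary part of the spiral equation in coordinate 3. As an equivalence it also
  yields the sextic for an arbitrary spiral point in \<open>spiral_unique\<close>.\<close>

lemma sp_switch_imag_iff:
  assumes r: "r > 0"
  shows "4 * spD r * spT r + 6 * spB r * spT r ^ 2 + spT r ^ 3 = - 2 * r ^ 3 * spE r
    \<longleftrightarrow> poly spiral_poly r = 0"
proof -
  note m = sp_mult[OF r] and d = spiral_denominators[OF r]
  \<comment> \<open>Chosen so that the right side is \<open>spT r * k\<close>; the positive factor
    \<open>spT r\<close> then cancels from both sides.\<close>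
  define k where "k = 4 * r ^ 4 / (1 + r ^ 3)"
  have k: "(1 + r ^ 3) * k = 4 * r ^ 4" using d by (simp add: k_def)
  have "(1 + r) * (1 + r ^ 3) * (- 2 * r ^ 3 * spE r - spT r * k) = 0"
    using m(4,5) k by algebra
  then have E: "- 2 * r ^ 3 * spE r = spT r * k" using d by simp
  let ?c = "9 * (1 + r)\<^sup>2 * (1 - r + r\<^sup>2)"
  have e: "?c * (4 * spD r) = 12 * (1 - 3 * r - 2 * r ^ 2 - 3 * r ^ 3 + r ^ 4)"
    "?c * (6 * spB r * spT r) = 12 * (1 - r + r\<^sup>2) * (r - 1) * (1 + r + r ^ 2)"
    "?c * spT r ^ 2 = 4 * (1 - r + r\<^sup>2) * (1 + r + r ^ 2) ^ 2"
    "?c * k = 36 * (1 + r) * r ^ 4"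
    using m(1,3,5) k d(4) by algebra+
  have "?c * (4 * spD r + 6 * spB r * spT r + spT r ^ 2 - k) = 4 * poly spiral_poly r"
    unfolding distrib_left[of ?c] right_diff_distrib[of ?c] e spiral_poly_eval by algebra
  moreover have "?c \<noteq> 0" using d by simp
  ultimately have "poly spiral_poly r = 0 \<longleftrightarrow> 4 * spD r + 6 * spB r * spT r + spT r ^ 2 - k = 0"
    by (metis mult_eq_0_iff zero_neq_numeral)
  also have "\<dots> \<longleftrightarrow> spT r * (4 * spD r + 6 * spB r * spT r + spT r ^ 2) = spT r * k"
    using spT_pos[OF r] by simp
  finally show ?thesis unfolding E by (simp add: algebra_simps power2_eq_square power3_eq_cube)
qed

text \<open>The quadratic \<open>4 * spD r + 6 * spB r * t + t ^ 2\<close>, a factor of the gap to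
  \<open>zeta\<^sup>2\<close>, has negative discriminant.\<close>

lemma sp_discriminant:
  assumes "spiral_ratio r"
  shows "9 * spB r ^ 2 < 4 * spD r"
proof -
  have r: "r > 0" using assms by (simp add: spiral_ratio_def)
  note m = sp_mult[OF r] and d = spiral_denominators[OF r]
  have "3 * (1 + r)\<^sup>2 * (1 - r + r\<^sup>2) * (4 * spD r - 9 * spB r ^ 2) = r ^ 4 - 3 * r ^ 3 - 20 * r ^ 2 - 3 * r + 1"
    using m(1,3) d(4) by algebra
  also have "\<dots> > 0" by (rule spiral_ratio_quartic[OF assms])
  finally show ?thesis by (rule zero_less_mult_pos[THEN diff_gt_0_iff_gt[THEN iffD1]])
      (use d(1,3) in simp)
qed

lemma q_rep_eq:
  assumes "spiral_ratio r"
  shows "q_rep r = (Complex (- 1) (sqrt 3 * spB r), Complex (sqrt 3 * spC r) (spD r), of_real (spE r))"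
proof -
  have r: "r > 0" "poly spiral_poly r = 0" using assms by (auto simp: spiral_ratio_def)
  note d = spiral_denominators[OF r(1)]
  have s: "x / (sqrt 3 * y) = sqrt 3 * (x / (3 * y))" for x y :: real
    by (cases "y = 0") (simp_all add: frac_eq_eq)
  have D: "3 * (1 + r + r ^ 3 + r ^ 4) = 3 * (1 + r) * (1 + r ^ 3)" by algebra
  let ?N = "1 + r - 4 * r ^ 3 - 7 * r ^ 4 - 9 * r ^ 5 - 7 * r ^ 6 - 4 * r ^ 7 + r ^ 9 + r ^ 10"
  let ?M = "9 * (1 + r) ^ 2 * (1 - r + r ^ 2) * (1 + r ^ 3 + r ^ 6)"
  have "?N = 6 * r * (1 + r + r\<^sup>2) * (1 + r ^ 3 + r ^ 6)"
  proof -
    \<comment> \<open>Division by the sextic leaves a remainder containing the factor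
      \<open>1 + r ^ 3 + r ^ 6\<close> of the denominator, which cancels.\<close>
    have "?N = 6 * r * (1 + r + r\<^sup>2) * (1 + r ^ 3 + r ^ 6) + (1 + r\<^sup>2 + r ^ 4) * poly spiral_poly r"
      unfolding spiral_poly_eval by algebra
    then show ?thesis using r(2) by simp
  qed
  moreover have "9 * (1 + r) ^ 2 * (1 - r + r ^ 2) = 3 * (3 * (1 + r) * (1 + r ^ 3))"
    unfolding d(4) by algebra
  moreover have "- 2 * (6 * r * x * w) / (3 * y * w) = - 4 * r * x / y" if "w \<noteq> 0" for w x y :: real
    using that by (cases "y = 0") (simp_all add: frac_eq_eq)
  moreover have "1 + r ^ 3 + r ^ 6 \<noteq> 0" using r(1) by (simp add: add_pos_pos less_imp_neq[symmetric])
  ultimately have E: "- 2 * ?N / ?M = spE r"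
    by (simp only: spE_def)
  have B: "(- 1 + r) / (sqrt 3 * (1 + r)) = sqrt 3 * spB r"
    unfolding s spB_def by simp
  have C: "- ((- 1 + r ^ 3) / (sqrt 3 * (1 + r ^ 3))) = sqrt 3 * spC r"
    unfolding s spC_def by simp
  show ?thesis
    by (simp only: q_rep_def B C E D spD_def)
qed

section \<open>The spiral equation in real coordinates\<close>

definition period :: "real \<Rightarrow> real" where "period r = sqrt 3 * spT r"

lemma period_eq: "period r = 2 * (1 + r + r ^ 2) / (sqrt 3 * (r + 1))"
proof -
  have "sqrt 3 * (x / (3 * y)) = x / (sqrt 3 * y)" for x y :: real
    by (cases "y = 0") (simp_all add: frac_eq_eq)
  then show ?thesis by (simp only: period_def spT_def add.commute[of r 1])
qed

lemma period_pos: "r > 0 \<Longrightarrow> period r > 0"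
  by (simp add: period_def spT_pos)

lemma sqrt3_power: "sqrt 3 * sqrt 3 = 3" "(sqrt 3)\<^sup>2 = 3" "sqrt 3 ^ 3 = 3 * sqrt 3"
  by (simp_all add: power3_eq_cube)

lemma arc_coords:
  "fuller_arc zeta (Complex a (sqrt 3 * b), Complex (sqrt 3 * c) d, of_real e) (sqrt 3 * t) =
    (Complex (a + 3 / 2 * t) (sqrt 3 * (b + t / 2)),
     Complex (sqrt 3 * (c + a * t + 3 / 4 * t ^ 2)) (d + 3 * b * t + 3 / 4 * t ^ 2),
     Complex (e + 3 * c * t + 3 / 2 * a * t ^ 2 + 3 / 4 * t ^ 3) (sqrt 3 * (d * t + 3 / 2 * b * t ^ 2 + t ^ 3 / 4)))"
proof -
  let ?q = "sqrt 3"
  have 1: "Complex a (?q * b) - \<i> * zeta * of_real (?q * t) = Complex (a + 3 / 2 * t) (?q * (b + t / 2))"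
    by (auto simp: complex_eq_iff algebra_simps)
  have 2: "Complex (?q * c) d + Complex a (?q * b) * of_real (?q * t) - \<i> * zeta * of_real (?q * t) ^ 2 / 2
    = Complex (?q * (c + a * t + 3 / 4 * t ^ 2)) (d + 3 * b * t + 3 / 4 * t ^ 2)"
    unfolding of_real_power[symmetric] power_mult_distrib sqrt3_power
    by (simp add: complex_eq_iff algebra_simps)
  have 3: "of_real e + Complex (?q * c) d * of_real (?q * t) + Complex a (?q * b) * of_real (?q * t) ^ 2 / 2
      - \<i> * zeta * of_real (?q * t) ^ 3 / 6
    = Complex (e + 3 * c * t + 3 / 2 * a * t ^ 2 + 3 / 4 * t ^ 3) (?q * (d * t + 3 / 2 * b * t ^ 2 + t ^ 3 / 4))"
    unfolding of_real_power[symmetric] power_mult_distrib sqrt3_power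
    by (simp add: complex_eq_iff algebra_simps)
  show ?thesis unfolding fuller_arc_def prod.case 1 2 3 ..
qed

lemma virial_coords:
  "virial (zeta\<^sup>2, r) (Complex a (sqrt 3 * b), Complex (sqrt 3 * c) d, of_real e) =
    (Complex (r * (3 / 2 * b - a / 2)) (sqrt 3 * (r * (- a / 2 - b / 2))),
     Complex (sqrt 3 * (r ^ 2 * (d / 2 - c / 2))) (r ^ 2 * (- 3 / 2 * c - d / 2)),
     Complex (- (r ^ 3) * e / 2) (sqrt 3 * (- (r ^ 3) * e / 2)))"
  unfolding virial_Pair prod.inject
  by (simp add: complex_eq_iff algebra_simps)

text \<open>In these units \<open>sqrt 3\<close> cancels from every component, leaving six equations
  with rational coefficients. They serve both to verify \<open>q_rep\<close> and to show that
  nothing else solves them.\<close>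

lemma arc_eq_virial_iff:
  "fuller_arc zeta (Complex a (sqrt 3 * b), Complex (sqrt 3 * c) d, of_real e) (sqrt 3 * t)
     = virial (zeta\<^sup>2, r) (Complex a (sqrt 3 * b), Complex (sqrt 3 * c) d, of_real e) \<longleftrightarrow>
   2 * a + 3 * t = r * (3 * b - a) \<and> 2 * b + t = - r * (a + b) \<and>
   4 * c + 4 * a * t + 3 * t ^ 2 = 2 * r ^ 2 * (d - c) \<and>
   4 * d + 12 * b * t + 3 * t ^ 2 = - 2 * r ^ 2 * (3 * c + d) \<and>
   4 * e + 12 * c * t + 6 * a * t ^ 2 + 3 * t ^ 3 = - 2 * r ^ 3 * e \<and>
   4 * d * t + 6 * b * t ^ 2 + t ^ 3 = - 2 * r ^ 3 * e"
proof -
  have "a + 3 / 2 * t = r * (3 / 2 * b - a / 2) \<longleftrightarrow> 2 * a + 3 * t = r * (3 * b - a)"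
    "b + t / 2 = r * (- a / 2 - b / 2) \<longleftrightarrow> 2 * b + t = - r * (a + b)"
    "c + a * t + 3 / 4 * t ^ 2 = r ^ 2 * (d / 2 - c / 2) \<longleftrightarrow> 4 * c + 4 * a * t + 3 * t ^ 2 = 2 * r ^ 2 * (d - c)"
    "d + 3 * b * t + 3 / 4 * t ^ 2 = r ^ 2 * (- 3 / 2 * c - d / 2) \<longleftrightarrow>
      4 * d + 12 * b * t + 3 * t ^ 2 = - 2 * r ^ 2 * (3 * c + d)"
    "e + 3 * c * t + 3 / 2 * a * t ^ 2 + 3 / 4 * t ^ 3 = - (r ^ 3) * e / 2 \<longleftrightarrow>
      4 * e + 12 * c * t + 6 * a * t ^ 2 + 3 * t ^ 3 = - 2 * r ^ 3 * e"
    "d * t + 3 / 2 * b * t ^ 2 + t ^ 3 / 4 = - (r ^ 3) * e / 2 \<longleftrightarrow> 4 * d * t + 6 * b * t ^ 2 + t ^ 3 = - 2 * r ^ 3 * e"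
    by (auto simp: field_simps)
  moreover have "sqrt 3 \<noteq> (0::real)" by simp
  ultimately show ?thesis
    unfolding arc_coords virial_coords prod.inject complex.inject mult_cancel_left by blast
qed

lemma q_rep_spiral:
  assumes "spiral_ratio r"
  shows "fuller_arc zeta (q_rep r) (period r) = virial (zeta\<^sup>2, r) (q_rep r)"
proof -
  have r: "r > 0" "poly spiral_poly r = 0" using assms by (auto simp: spiral_ratio_def)
  show ?thesis
    unfolding q_rep_eq[OF assms] period_def arc_eq_virial_iff
    using sp_eqs[OF r(1)] sp_switch_real[OF r] sp_switch_imag_iff[OF r(1)] r(2)
    by (simp add: algebra_simps)
qed

text \<open>Stated with a scale \<open>r\<close> so as to cover both gaps: scale 1 with
  \<open>spB r\<close> in elapsed time, and scale \<open>r\<close> with \<open>- spB r\<close> in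
  remaining time.\<close>

lemma spiral_quadratic_pos:
  fixes b d x r :: real
  assumes "9 * b ^ 2 < 4 * d" "r > 0"
  shows "4 * r ^ 2 * d + 6 * b * r * x + x ^ 2 > 0"
proof -
  have "4 * r ^ 2 * d + 6 * b * r * x + x ^ 2 = (x + 3 * b * r) ^ 2 + r ^ 2 * (4 * d - 9 * b ^ 2)"
    by algebra
  also have "\<dots> > 0" using assms by (intro add_nonneg_pos) simp_all
  finally show ?thesis .
qed

text \<open>The gap to \<open>zeta\<^sup>2\<close> vanishes at time 0 and the gap to 1 at the end; after removing that root each
  is the same quadratic without real roots, once in the elapsed time and once, by
  time reversal, in the remaining time.\<close>

lemma q_rep_gaps:
  assumes sr: "spiral_ratio r"
  shows "gap zeta (zeta\<^sup>2) (q_rep r) (sqrt 3 * t) = 3 / 4 * t * (4 * 1 ^ 2 * spD r + 6 * spB r * 1 * t + t ^ 2)"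
    and "gap zeta 1 (q_rep r) (sqrt 3 * t)
      = 3 / 4 * (spT r - t) * (4 * r ^ 2 * spD r + 6 * (- spB r) * r * (spT r - t) + (spT r - t) ^ 2)"
proof -
  have r: "r > 0" "poly spiral_poly r = 0" using sr by (auto simp: spiral_ratio_def)
  define B C D E T where "B = spB r" and "C = spC r" and "D = spD r" and "E = spE r" and "T = spT r"
  note defs = B_def[symmetric] C_def[symmetric] D_def[symmetric] E_def[symmetric] T_def[symmetric]
  show "gap zeta (zeta\<^sup>2) (q_rep r) (sqrt 3 * t) = 3 / 4 * t * (4 * 1 ^ 2 * spD r + 6 * spB r * 1 * t + t ^ 2)"
    by (simp add: gap_def q_rep_eq[OF sr] arc_coords Re_pair_def)
      (simp add: algebra_simps power2_eq_square power3_eq_cube)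
  note e = sp_eqs[OF r(1), unfolded defs] sp_switch_real[OF r, unfolded defs]
    sp_switch_imag_iff[OF r(1), THEN iffD2, OF r(2), unfolded defs]
  \<comment> \<open>Relation \<open>3\<close> says that the gap to 1 vanishes at the end, so that
    \<open>T - t\<close> splits off; \<open>1\<close> and \<open>2\<close> bring the remaining
    quadratic into the time-reversed form.\<close>
  have 1: "1 + B = T - 2 * B * r" using e(1,2) by algebra
  have 2: "2 * (D - 3 * C) = - 4 * r ^ 2 * D + 12 * B * r * T - 3 * T ^ 2" using e(3,4) 1 by algebra
  have 3: "2 * E = 3 * (1 + B) * T ^ 2 - T ^ 3 + 2 * (D - 3 * C) * T" using e(6,7) by algebra
  have "gap zeta 1 (q_rep r) (sqrt 3 * t) = 3 / 4 * (- (2 * E) + 2 * (D - 3 * C) * t + 3 * (1 + B) * t ^ 2 - t ^ 3)"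
    by (simp add: gap_def q_rep_eq[OF sr] arc_coords Re_pair_def defs)
      (simp add: field_simps power2_eq_square power3_eq_cube)
  also have "\<dots> = 3 / 4 * (T - t) * (4 * r ^ 2 * D + 6 * (- B) * r * (T - t) + (T - t) ^ 2)"
    unfolding 3 2 1 by algebra
  finally show "gap zeta 1 (q_rep r) (sqrt 3 * t)
      = 3 / 4 * (spT r - t) * (4 * r ^ 2 * spD r + 6 * (- spB r) * r * (spT r - t) + (spT r - t) ^ 2)"
    by (simp only: defs)
qed

lemma q_rep_switches:
  assumes sr: "spiral_ratio r"
  shows "switches (q_rep r) zeta (period r)"
proof -
  have r: "r > 0" using sr by (simp add: spiral_ratio_def)
  note disc = sp_discriminant[OF sr]
  have disc': "9 * (- spB r) ^ 2 < 4 * spD r" using disc by simp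
  have others: "V_T - {zeta} = {zeta\<^sup>2, 1}" 
    using V_T_others[of zeta] by (simp add: zeta_mult)
  have "gap zeta v (q_rep r) t > 0" if v: "v \<in> V_T - {zeta}" and t: "0 < t" "t < period r" for v t
  proof -
    define s where "s = t / sqrt 3"
    have ts: "t = sqrt 3 * s" by (simp add: s_def)
    have s: "0 < s" "s < spT r" using t by (auto simp: s_def period_def field_simps)
    have "gap zeta (zeta\<^sup>2) (q_rep r) t > 0"
      unfolding ts q_rep_gaps(1)[OF sr] using s(1) by (intro mult_pos_pos spiral_quadratic_pos disc) simp_all
    moreover have "gap zeta 1 (q_rep r) t > 0"
      unfolding ts q_rep_gaps(2)[OF sr] using s(2) r by (intro mult_pos_pos spiral_quadratic_pos disc') simp_all
    ultimately show ?thesis using v unfolding others by auto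
  qed
  moreover have "gap zeta 1 (q_rep r) (period r) = 0"
    unfolding period_def q_rep_gaps(2)[OF sr] by simp
  ultimately show ?thesis
    using period_pos[OF r] zeta_distinct by (auto simp: switches_def)
qed

section \<open>The Hamiltonian and uniqueness of the spiral point\<close>

lemma fuller_ham_virial:
  assumes "w \<in> V_T"
  shows "fuller_ham (virial (w, r) z) (w * u) = r ^ 3 * fuller_ham z u"
proof -
  obtain z1 z2 z3 where z: "z = (z1, z2, z3)" by (cases z)
  have "cnj (w * of_real r * z1) * (\<i> * (w * of_real (r ^ 2) * z2)) = cnj w * w * (of_real (r ^ 3) * (cnj z1 * (\<i> * z2)))"
    "cnj (w * u) * (w * of_real (r ^ 3) * z3) = cnj w * w * (of_real (r ^ 3) * (cnj u * z3))"
    by (simp_all add: algebra_simps power2_eq_square power3_eq_cube)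
  then show ?thesis
    unfolding z fuller_ham_def virial_Pair comp_simps Re_pair_def V_T_cnj_mult(1)[OF assms]
    by (simp only: Re_complex_of_real times_complex.sel mult_1 mult_zero_left diff_0_right Im_complex_of_real distrib_left)
qed

text \<open>After a dilation the equations are solved coordinate by coordinate: the first two
  coordinates by linear systems, the third by the Hamiltonian. One remaining equation is the
  sextic.\<close>

lemma spiral_unique:
  assumes t: "t > 0" and r: "r > 0" and z3: "Im (comp3 z) = 0"
    and switch: "fuller_arc zeta z t = virial (zeta\<^sup>2, r) z" and ham: "fuller_ham z zeta = 0"
  shows "spiral_ratio r" "z = virial (1, t / period r) (q_rep r)"
proof -
  \<comment> \<open>The dilation normalises the duration to \<open>period r\<close>; that the first
    coordinate then has real part \<open>- 1\<close> is a consequence.\<close>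
  define k where "k = period r / t"
  have k: "k > 0" "k * t = period r" using t period_pos[OF r] by (simp_all add: k_def)
  define y where "y = virial (1, k) z"
  have z_y: "z = virial (1, t / period r) y"
    using k t by (simp add: y_def virial_virial flip: k(2))
  have sw: "fuller_arc zeta y (sqrt 3 * spT r) = virial (zeta\<^sup>2, r) y"
    using arc_virial[of 1 zeta k z t] k(2) switch
    by (simp add: y_def virial_virial mult.commute period_def)
  have "fuller_ham y zeta = 0"
    using fuller_ham_virial[of 1 k z zeta] ham by (simp add: y_def)
  have "Im (comp3 y) = 0" using z3 by (cases z) (simp add: y_def virial_Pair flip: of_real_power)
  obtain y1 y2 y3 where y: "y = (y1, y2, y3)" by (cases y)
  define a b c d e where "a = Re y1" and "b = Im y1 / sqrt 3" and "c = Re y2 / sqrt 3"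
    and "d = Im y2" and "e = Re y3"
  have y': "y = (Complex a (sqrt 3 * b), Complex (sqrt 3 * c) d, of_real e)"
    using \<open>Im (comp3 y) = 0\<close> by (simp add: y a_def b_def c_def d_def e_def complex_eq_iff)
  define B C D E T where "B = spB r" and "C = spC r" and "D = spD r" and "E = spE r" and "T = spT r"
  note defs = B_def[symmetric] C_def[symmetric] D_def[symmetric] E_def[symmetric] T_def[symmetric]
  note s = sp_eqs[OF r, unfolded defs]
  have q: "2 * a + 3 * T = r * (3 * b - a)" "2 * b + T = - r * (a + b)"
    "4 * c + 4 * a * T + 3 * T ^ 2 = 2 * r ^ 2 * (d - c)"
    "4 * d + 12 * b * T + 3 * T ^ 2 = - 2 * r ^ 2 * (3 * c + d)"
    "4 * d * T + 6 * b * T ^ 2 + T ^ 3 = - 2 * r ^ 3 * e"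
    using sw unfolding y' arc_eq_virial_iff defs by blast+
  have nz: "1 + r + r ^ 2 \<noteq> 0" "1 + r ^ 2 + r ^ 4 \<noteq> 0"
    using r by (simp_all add: add_pos_pos less_imp_neq[symmetric])
  \<comment> \<open>The differences from the known solution satisfy a homogeneous linear system of
    determinant \<open>4 * (1 + r + r ^ 2)\<close>; for the second coordinate it is
    \<open>16 * (1 + r ^ 2 + r ^ 4)\<close>.\<close>
  have "(1 + r + r ^ 2) * (a + 1) = 0" "(1 + r + r ^ 2) * (b - B) = 0"
    using q(1,2) s(1,2) by algebra+
  then have ab: "a = - 1" "b = B" using nz by auto
  have "(1 + r ^ 2 + r ^ 4) * (c - C) = 0" "(1 + r ^ 2 + r ^ 4) * (d - D) = 0"
    using q(3,4) s(3,4) unfolding ab by algebra+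
  then have cd: "c = C" "d = D" using nz by auto
  have "fuller_ham y zeta = - a * d + 3 * b * c - e / 2"
    by (simp add: y' fuller_ham_def Re_pair_def)
  then have e: "e = E" using \<open>fuller_ham y zeta = 0\<close> s(5) unfolding ab cd by simp
  show sr: "spiral_ratio r"
    using sp_switch_imag_iff[OF r, unfolded defs] q(5) r unfolding ab cd e by (simp add: spiral_ratio_def)
  show "z = virial (1, t / period r) (q_rep r)"
    unfolding q_rep_eq[OF sr] defs using z_y y' unfolding ab cd e by simp
qed

section \<open>Orbits of the virial group\<close>

lemma phi_virial:
  assumes "w \<in> V_T" "r > 0"
  shows "phi (virial (w, r) z) = r * phi z"
proof -
  obtain z1 z2 z3 where z: "z = (z1, z2, z3)" by (cases z)
  have norms: "cmod (w * of_real r * z1) = r * cmod z1" "cmod (w * of_real (r ^ 2) * z2) = r ^ 2 * cmod z2"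
    "cmod (w * of_real (r ^ 3) * z3) = r ^ 3 * cmod z3"
    using assms(2) V_T_norm[OF assms(1)] by (simp_all add: norm_mult norm_power)
  have "(r * x) ^ 6 + (r ^ 2 * y) ^ 3 + (r ^ 3 * t) ^ 2 = r ^ 6 * (x ^ 6 + y ^ 3 + t ^ 2)" for x y t
    by algebra
  moreover have "(r ^ 6) powr (1 / 6) = r"
  proof -
    have "r ^ 6 = r powr 6" using assms(2) by (simp add: powr_numeral)
    then show ?thesis using assms(2) by (simp only: powr_powr) simp
  qed
  ultimately show ?thesis
    unfolding phi_def z virial_Pair comp_simps norms by (simp only: powr_mult)
qed

lemma phi_pos: "z \<noteq> 0 \<Longrightarrow> phi z > 0"
proof -
  assume "z \<noteq> 0"
  then have "cmod (comp1 z) ^ 6 + cmod (comp2 z) ^ 3 + cmod (comp3 z) ^ 2 > 0"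
    by (cases z) (auto simp: zero_prod_def less_le add_nonneg_eq_0_iff)
  then show ?thesis by (simp add: phi_def)
qed

lemma phi_0 [simp]: "phi 0 = 0"
  by (simp add: phi_def zero_prod_def)

lemma ang_virial:
  assumes "w \<in> V_T" "r > 0"
  shows "ang (virial (w, r) z) = virial (w, 1) (ang z)"
proof -
  have "inverse (r * phi z) * r = inverse (phi z)" using assms(2) by simp
  then show ?thesis
    unfolding ang_def phi_virial[OF assms] virial_virial by (simp only: mult_1_left mult_1_right)
qed

lemma walls_mult: "x \<in> walls \<Longrightarrow> w \<in> V_T \<Longrightarrow> r \<ge> 0 \<Longrightarrow> w * of_real r * x \<in> walls"
proof -
  assume "x \<in> walls" "w \<in> V_T" "r \<ge> 0"
  then obtain y v where "x = of_real y * v" "y \<le> 0" "v \<in> V_T" by (auto simp: walls_def)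
  then have "w * of_real r * x = of_real (r * y) * (w * v)" "r * y \<le> 0" "w * v \<in> V_T"
    using \<open>w \<in> V_T\<close> \<open>r \<ge> 0\<close> by (auto simp: V_T_mult mult_nonneg_nonpos)
  then show ?thesis unfolding walls_def by blast
qed

lemma walls_virial:
  assumes "comp3 z \<in> walls" "w \<in> V_T" "r > 0"
  shows "comp3 (virial (w, r) z) \<in> walls"
  using assms walls_mult[of "comp3 z" w "r ^ 3"] by (cases z) (simp add: virial_Pair)

lemma virial_eq_0_iff:
  assumes "w \<in> V_T" "r > 0"
  shows "virial (w, r) z = 0 \<longleftrightarrow> z = 0"
  using assms V_T_norm[of w] by (cases z) (auto simp: virial_def zero_prod_def)

lemma Xi_W_virial: "\<xi> \<in> Xi_W \<Longrightarrow> w \<in> V_T \<Longrightarrow> virial (w, 1) \<xi> \<in> Xi_W"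
  by (simp add: Xi_W_def phi_virial walls_virial)

lemma Xi_W_nonzero: "\<xi> \<in> Xi_W \<Longrightarrow> \<xi> \<noteq> 0"
  by (auto simp: Xi_W_def)

lemma ang_in_Xi_W: "z \<noteq> 0 \<Longrightarrow> comp3 z \<in> walls \<Longrightarrow> ang z \<in> Xi_W"
  using phi_pos[of z] by (simp add: Xi_W_def ang_def phi_virial walls_virial)

lemma ang_Xi_W: "\<xi> \<in> Xi_W \<Longrightarrow> ang \<xi> = \<xi>"
  by (simp add: Xi_W_def ang_def)

lemma V_rel_iff: "(x, y) \<in> V_rel \<longleftrightarrow> x \<in> Xi_W \<and> (\<exists>w\<in>V_T. y = virial (w, 1) x)"
  unfolding V_rel_def using Xi_W_virial by blast

lemma V_rel_orbit: "\<xi> \<in> Xi_W \<Longrightarrow> V_rel `` {\<xi>} = (\<lambda>w. virial (w, 1) \<xi>) ` V_T"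
  unfolding Image_singleton V_rel_iff by blast

lemma equiv_V_rel: "equiv Xi_W V_rel"
proof (rule equivI)
  show "V_rel \<subseteq> Xi_W \<times> Xi_W" unfolding V_rel_def by blast
  show "refl_on Xi_W V_rel"
    unfolding refl_on_def V_rel_iff using V_T_I(1) virial_1 by metis
  show "sym V_rel"
  proof (rule symI)
    fix x y assume "(x, y) \<in> V_rel"
    then obtain w where w: "w \<in> V_T" "y = virial (w, 1) x" "y \<in> Xi_W"
      unfolding V_rel_iff using Xi_W_virial by blast
    then have "x = virial (cnj w, 1) y" by (simp add: virial_virial V_T_cnj_mult)
    then show "(y, x) \<in> V_rel" unfolding V_rel_iff using w V_T_cnj by blast
  qed
  show "trans V_rel"
  proof (rule transI)
    fix x y z assume "(x, y) \<in> V_rel" "(y, z) \<in> V_rel"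
    then obtain v w where "v \<in> V_T" "y = virial (v, 1) x" "w \<in> V_T" "z = virial (w, 1) y" "x \<in> Xi_W"
      unfolding V_rel_iff by blast
    then have "z = virial (w * v, 1) x" "w * v \<in> V_T" "x \<in> Xi_W" by (simp_all add: virial_virial V_T_mult)
    then show "(x, z) \<in> V_rel" unfolding V_rel_iff by blast
  qed
qed

text \<open>The part of the Hamiltonian pairing the first two coordinates does not depend on the
  control and cancels.\<close>

lemma fuller_ham_diff: "fuller_ham (fuller_arc u z t) u - fuller_ham (fuller_arc u z t) v = gap u v z t"
  by (simp add: fuller_ham_def gap_def Re_pair_def algebra_simps)

lemma switches_ham_max:
  assumes "switches z u T" "0 \<le> t" "t \<le> T" "v \<in> V_T"
  shows "fuller_ham (fuller_arc u z t) v \<le> fuller_ham (fuller_arc u z t) u"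
  using fuller_ham_diff[of u z t v] gap_nonneg[OF assms(1,4,2,3)] by simp

lemma ham_vanishes_iff:
  assumes "switches z u T"
  shows "ham_vanishes z \<longleftrightarrow> fuller_ham z u = 0"
proof -
  have "u \<in> V_T" "T > 0" using assms by (auto simp: switches_def)
  then have "Max (fuller_ham z ` V_T) = fuller_ham z u"
    using switches_ham_max[OF assms, of 0] by (intro Max_eqI) auto
  then show ?thesis by (simp add: ham_vanishes_def)
qed

lemma q_rep_ham: "spiral_ratio r \<Longrightarrow> fuller_ham (q_rep r) zeta = 0"
  using sp_eqs(5)[of r] sqrt3_power(1)
  by (simp add: q_rep_eq fuller_ham_def Re_pair_def spiral_ratio_def) (simp add: algebra_simps)

section \<open>Spiral points and their trajectories\<close>

lemma virial_spiral_point: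
  assumes "spiral_ratio r" "w \<in> V_T" "k > 0"
  defines "\<xi> \<equiv> virial (w, k) (q_rep r)"
  shows "switches \<xi> (w * zeta) (k * period r)"
    and "fuller_arc (w * zeta) \<xi> (k * period r) = virial (zeta\<^sup>2, r) \<xi>"
    and "ham_vanishes \<xi>" "\<xi> \<noteq> 0" "comp3 \<xi> \<in> walls"
proof -
  have r: "r > 0" using assms by (simp add: spiral_ratio_def)
  show sw: "switches \<xi> (w * zeta) (k * period r)"
    unfolding \<xi>_def by (rule switches_virial[OF q_rep_switches[OF assms(1)] assms(2,3)])
  show "fuller_arc (w * zeta) \<xi> (k * period r) = virial (zeta\<^sup>2, r) \<xi>"
    unfolding \<xi>_def arc_virial q_rep_spiral[OF assms(1)] virial_virial by (simp only: mult.commute)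
  show "ham_vanishes \<xi>"
    unfolding ham_vanishes_iff[OF sw] unfolding \<xi>_def fuller_ham_virial[OF assms(2)]
    by (simp add: q_rep_ham assms)
  have "comp3 (q_rep r) \<in> walls"
    using spE_neg[OF r] unfolding q_rep_eq[OF assms(1)] comp_simps walls_def
    by (intro CollectI exI[of _ "spE r"] exI[of _ 1]) simp
  then show "comp3 \<xi> \<in> walls" using assms by (simp add: walls_virial)
  have "q_rep r \<noteq> 0" by (simp add: q_rep_def zero_prod_def complex_eq_iff)
  then show "\<xi> \<noteq> 0" using assms by (simp add: virial_eq_0_iff)
qed

text \<open>By equivariance the \<open>n\<close>-th arc is the image of the first under the
  \<open>n\<close>-th power of the group element, with duration \<open>r ^ n * T\<close>;
  consecutive arcs fit together.\<close>

lemma spiral_trajectory: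
  assumes sw: "switches \<xi> u T" and closes: "fuller_arc u \<xi> T = virial (w, r) \<xi>"
    and w: "w \<in> V_T" and r: "r > 0" and \<xi>: "\<xi> \<noteq> 0" "comp3 \<xi> \<in> walls"
  shows "\<exists>z s. triangular_spiral z s (w, r) \<and> (\<forall>n. z (s n) = virial (w ^ n, r ^ n) \<xi>)"
proof -
  define x where "x n = virial (w ^ n, r ^ n) \<xi>" for n
  define c where "c n = w ^ n * u" for n
  define s where "s n = (\<Sum>k<n. r ^ k * T)" for n
  \<comment> \<open>The least index picks the arc containing \<open>t\<close>. For
    \<open>r < 1\<close> the switching times are bounded and the values after all of them are
    arbitrary.\<close>
  define z where "z t = (let n = LEAST n. t < s (Suc n) in fuller_arc (c n) (x n) (t - s n))" for t
  have sw_n: "switches (x n) (c n) (r ^ n * T)" for n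
    unfolding x_def c_def by (rule switches_virial[OF sw]) (use w r V_T_power in auto)
  have s_Suc: "s (Suc n) = s n + r ^ n * T" for n by (simp add: s_def)
  have s_less: "s n < s (Suc n)" for n
    using r sw by (simp add: s_Suc switches_def)
  then have s_mono: "s m \<le> s n" if "m \<le> n" for m n
    using that by (simp add: lift_Suc_mono_le less_imp_le)
  have z_left: "z t = fuller_arc (c n) (x n) (t - s n)" if "s n \<le> t" "t < s (Suc n)" for n t
  proof -
    have "(LEAST n. t < s (Suc n)) = n"
    proof (rule Least_equality)
      fix m assume "t < s (Suc m)"
      then show "n \<le> m" using s_mono[of "Suc m" n] that(1) by (cases "n \<le> m") auto
    qed (rule that(2))
    then show ?thesis by (simp add: z_def)
  qed
  have x_Suc: "x (Suc n) = virial (w, r) (x n)" for n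
    by (simp add: x_def virial_virial mult.commute)
  have arc_n: "fuller_arc (c n) (x n) (r ^ n * T) = x (Suc n)" for n
    unfolding x_def c_def arc_virial closes virial_virial by (simp add: mult.commute)
  have z_s: "z (s n) = x n" for n
    using z_left[of n "s n"] s_less[of n] by simp
  \<comment> \<open>At the right endpoint \<open>z\<close> already follows the next arc, whose
    initial point is the end of this one.\<close>
  have z_eq: "z t = fuller_arc (c n) (x n) (t - s n)" if "t \<in> {s n..s (Suc n)}" for n t
    using that z_left[of n t] z_s[of "Suc n"] arc_n[of n] s_Suc[of n]
    by (cases "t = s (Suc n)") auto
  have "fuller_trajectory z s"
    unfolding fuller_trajectory_def
  proof (intro conjI allI)
    show "s 0 = 0" by (simp add: s_def)
  next
    fix n
    show "z (s n) \<noteq> 0" "comp3 (z (s n)) \<in> walls"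
      using w r \<xi> V_T_power unfolding z_s x_def by (auto simp: virial_eq_0_iff walls_virial)
    show "s (Suc n) = s n + t_sw (z (s n))" by (simp add: z_s switches_t_sw[OF sw_n] s_Suc)
    show "s n < s (Suc n)" by (rule s_less)
    have "solves_fuller (c n) {s n..s (Suc n)} z"
      unfolding solves_fuller_def
    proof
      fix t assume t: "t \<in> {s n..s (Suc n)}"
      have "((\<lambda>t. fuller_arc (c n) (x n) (t - s n)) has_vector_derivative fuller_field (c n) (z t))
          (at t within {s n..s (Suc n)})"
        using arc_solves[of "c n" "{s n..s (Suc n)}" "x n" "s n"] t
        unfolding solves_fuller_def z_eq[OF t] by blast
      then show "(z has_vector_derivative fuller_field (c n) (z t)) (at t within {s n..s (Suc n)})"
        using z_eq by (rule has_vector_derivative_transform[OF t, rotated])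
    qed
    moreover have "is_arg_max (fuller_ham (z t)) (\<lambda>v. v \<in> V_T) (c n)" if t: "t \<in> {s n..s (Suc n)}" for t
    proof -
      have "c n \<in> V_T" using sw_n[of n] by (simp add: switches_def)
      moreover have "0 \<le> t - s n" "t - s n \<le> r ^ n * T" using t s_Suc[of n] by simp_all
      ultimately show ?thesis
        using switches_ham_max[OF sw_n[of n]] unfolding is_arg_max_def z_eq[OF t] by (simp add: not_less)
    qed
    ultimately show "let u = first_control (z (s n)) in solves_fuller u {s n..s (Suc n)} z \<and>
        (\<forall>t\<in>{s n..s (Suc n)}. is_arg_max (fuller_ham (z t)) (\<lambda>v. v \<in> V_T) u)"
      by (simp add: z_s switches_first_control[OF sw_n])
  qed
  then have "triangular_spiral z s (w, r)"
    using w r by (simp add: triangular_spiral_def virial_group_def z_s x_Suc)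
  then show ?thesis using z_s unfolding x_def by blast
qed

section \<open>Classification of the fixed points\<close>

text \<open>Exchanges \<open>zeta\<close> and \<open>zeta\<^sup>2\<close> without reversing time. It
  negates the Hamiltonian, turning maxima into minima, so it respects the spiral equation and the
  vanishing of the Hamiltonian but not the choice of control.\<close>

definition reflect :: "state \<Rightarrow> state" where
  "reflect = (\<lambda>(z1, z2, z3). (- cnj z1, - cnj z2, - cnj z3))"

lemma arc_reflect: "fuller_arc (cnj u) (reflect z) t = reflect (fuller_arc u z t)"
  by (cases z) (simp add: fuller_arc_def reflect_def)

lemma virial_reflect: "virial (cnj w, r) (reflect z) = reflect (virial (w, r) z)"
  by (cases z) (simp add: virial_def reflect_def)

lemma fuller_ham_reflect: "fuller_ham (reflect z) (cnj u) = - fuller_ham z u"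
  by (cases z) (simp add: fuller_ham_def reflect_def Re_pair_def algebra_simps)

text \<open>Without rotation, the three equations force all coordinates to be imaginary, so the third one
  vanishes, being on a wall; what remains of the equations is then \<open>r\<^sup>2 + r + 1 = 0\<close>.\<close>

lemma no_unrotated_spiral:
  assumes T: "T > 0" and r: "r > 0" and z3: "comp3 z = of_real x * v" "v \<in> V_T"
  shows "fuller_arc 1 z T \<noteq> virial (1, r) z"
proof
  assume eq: "fuller_arc 1 z T = virial (1, r) z"
  obtain z1 z2 z3 where z: "z = (z1, z2, z3)" by (cases z)
  have c1: "z1 - \<i> * of_real T = of_real r * z1"
    and c2: "z2 + z1 * of_real T - \<i> * of_real (T ^ 2) / 2 = of_real (r ^ 2) * z2"
    and c3: "z3 + z2 * of_real T + z1 * of_real (T ^ 2) / 2 - \<i> * of_real (T ^ 3) / 6 = of_real (r ^ 3) * z3"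
    using eq by (simp_all add: z fuller_arc_def virial_Pair)
  have a: "Re z1 * (1 - r) = 0" "Im z1 * (1 - r) = T"
    using arg_cong[OF c1, of Re] arg_cong[OF c1, of Im] by (simp_all add: algebra_simps)
  then have r1: "r \<noteq> 1" "Re z1 = 0" using T by auto
  have b: "Re z2 * (1 - r ^ 2) = 0" "Im z2 * (1 - r ^ 2) = T ^ 2 / 2 - Im z1 * T"
    using arg_cong[OF c2, of Re] arg_cong[OF c2, of Im] r1(2)
    by (simp_all add: algebra_simps del: of_real_power)
  have "r ^ 2 \<noteq> 1" "r ^ 3 \<noteq> 1"
  proof -
    have "r = 1" if "r ^ n = 1" "n > 0" for n
      using power_eq_imp_eq_base[of r n 1] that r by simp
    then show "r ^ 2 \<noteq> 1" "r ^ 3 \<noteq> 1" using r1(1) by fastforce+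
  qed
  then have r2: "Re z2 = 0" using b by simp
  have c: "Re z3 * (1 - r ^ 3) = 0"
    "Im z3 * (1 - r ^ 3) + Im z2 * T + Im z1 * T ^ 2 / 2 - T ^ 3 / 6 = 0"
    using arg_cong[OF c3, of Re] arg_cong[OF c3, of Im] r1(2) r2
    by (simp_all add: algebra_simps del: of_real_power)
  have "Re z3 = 0" using c \<open>r ^ 3 \<noteq> 1\<close> by simp
  then have "x = 0" using z3 by (auto simp: z V_T_def zeta_sq simp del: of_real_power)
  then have "z3 = 0" using z3 by (simp add: z)
  define A B where "A = Im z1" and "B = Im z2"
  have A: "T = A * (1 - r)" using a(2) by (simp add: A_def)
  then have A0: "A \<noteq> 0" "1 - r \<noteq> 0" using T by auto
  have "(1 - r) * (1 + r) * (2 * B + A ^ 2) = 0"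
    using b(2) unfolding A_def[symmetric] B_def[symmetric] A by algebra
  moreover have "(1 - r) * (1 + r) \<noteq> 0" using A0 r by simp
  ultimately have B: "2 * B + A ^ 2 = 0" by simp
  have "6 * B * T + 3 * A * T ^ 2 - T ^ 3 = 0"
    using c(2) \<open>z3 = 0\<close> by (simp add: A_def B_def)
  then have "- 3 * A ^ 2 * T + 3 * A * T ^ 2 - T ^ 3 = 0" using B by algebra
  then have "A ^ 3 * (1 - r) * ((1 - r) ^ 2 - 3 * (1 - r) + 3) = 0" unfolding A by algebra
  then have "(1 - r) ^ 2 - 3 * (1 - r) + 3 = 0" using A0 by simp
  moreover have "(1 - r) ^ 2 - 3 * (1 - r) + 3 = r ^ 2 + r + 1" by algebra
  moreover have "r ^ 2 + r + 1 > 0" using r by (intro add_pos_pos) simp_all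
  ultimately show False by linarith
qed

text \<open>Optimality of control 1 at both ends of the arc decides the wall: a nonzero third
  coordinate can lie neither on the ray of 1 at the start nor on it at the end. Since
  \<open>w\<close> is not 1, only \<open>v = w\<close> remains.\<close>

lemma normalized_fixed_point:
  assumes sw: "switches y 1 T" and closes: "fuller_arc 1 y T = virial (w, r) y"
    and w: "w \<in> V_T" and r: "r > 0" and walls: "comp3 y \<in> walls" and ham: "fuller_ham y 1 = 0"
  shows "spiral_ratio r \<and> (\<exists>k>0. virial (zeta, 1) y = virial (1, k) (q_rep r))"
proof -
  have T: "T > 0" using sw by (simp add: switches_def)
  obtain y1 y2 y3 where y: "y = (y1, y2, y3)" by (cases y)
  obtain x v where xv: "y3 = of_real x * v" "x \<le> 0" "v \<in> V_T"
    using walls by (auto simp: y walls_def)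
  have start: "Re_pair (1 - v') y3 \<ge> 0" if "v' \<in> V_T" for v'
    using gap_nonneg[OF sw that, of 0] T by (simp add: gap_def y)
  have stop: "Re_pair (1 - v') (w * y3) \<ge> 0" if "v' \<in> V_T" for v'
  proof -
    have "Re_pair (1 - v') (w * of_real (r ^ 3) * y3) \<ge> 0"
      using gap_nonneg[OF sw that, of T] T unfolding gap_def closes by (simp add: y virial_Pair)
    moreover have "cnj (1 - v') * (w * of_real (r ^ 3) * y3) = of_real (r ^ 3) * (cnj (1 - v') * (w * y3))"
      by simp
    moreover have "Re (of_real c * z) = c * Re z" for c z by simp
    ultimately have "r ^ 3 * Re_pair (1 - v') (w * y3) \<ge> 0"
      unfolding Re_pair_def by (simp only:)
    then show ?thesis using r by (simp add: zero_le_mult_iff)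
  qed
  \<comment> \<open>On the negative real axis control 1 is the worst of the three.\<close>
  have tie: "c = 0" if "c \<le> 0" "Re_pair (1 - zeta) (of_real c) \<ge> 0" for c :: real
    using that by (simp add: Re_pair_def)
  have "v = 1 \<Longrightarrow> x = 0"
    using start[of zeta] xv(2) by (intro tie) (auto simp: xv(1))
  have w1: "w \<noteq> 1"
    using no_unrotated_spiral[OF T r, of y x v] closes xv by (auto simp: y)
  have "x = 0" if "w * v = 1"
  proof (rule tie[OF xv(2)])
    have "w * y3 = of_real x" using that by (simp add: xv(1) mult.left_commute)
    then show "Re_pair (1 - zeta) (of_real x) \<ge> 0" using stop[of zeta] by simp
  qed
  then have cases: "x = 0 \<or> v = w"
    using w xv(3) w1 \<open>v = 1 \<Longrightarrow> x = 0\<close> by (auto simp: V_T_def zeta_mult)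
  then have y3: "y3 = of_real x * w" using xv(1) by auto
  have rotated: "fuller_arc zeta (virial (zeta, 1) y') T = virial (zeta\<^sup>2, r) (virial (zeta, 1) y')"
    if "fuller_arc 1 y' T = virial (zeta\<^sup>2, r) y'" for y'
    using arc_virial[of zeta 1 1 y' T] that by (simp add: virial_virial mult.commute)
  have rotated_ham: "fuller_ham (virial (zeta, 1) y') zeta = fuller_ham y' 1" for y'
    using fuller_ham_virial[of zeta 1 y' 1] by simp
  from w w1 show ?thesis
  proof (cases rule: V_T_E)
    case 3
    have "comp3 (virial (zeta, 1) y) = of_real x"
      using y3 3 by (simp add: y virial_Pair zeta_mult mult.left_commute)
    then show ?thesis
      using spiral_unique[OF T r _ rotated, of y] closes ham 3 T period_pos[OF r]
      by (auto simp: rotated_ham intro!: exI[of _ "T / period r"])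
  next
    case 2
    define q where "q = virial (zeta, 1) (reflect y)"
    have "fuller_arc 1 (reflect y) T = virial (zeta\<^sup>2, r) (reflect y)"
      using arc_reflect[of 1 y T] virial_reflect[of zeta r y] closes 2 by (simp add: cnj_zeta)
    note q_closes = rotated[OF this]
    have q_ham: "fuller_ham q zeta = 0"
      using fuller_ham_reflect[of y 1] ham by (simp add: q_def rotated_ham)
    have q3: "comp3 q = of_real (- x)"
      using y3 2 by (simp add: q_def y reflect_def virial_Pair cnj_zeta zeta_mult mult.left_commute)
    have "spiral_ratio r" and q: "q = virial (1, T / period r) (q_rep r)"
      using spiral_unique[OF T r _ q_closes[folded q_def] q_ham] q3 by simp_all
    have "comp3 q = of_real ((T / period r) ^ 3 * spE r)"
      unfolding q q_rep_eq[OF \<open>spiral_ratio r\<close>] virial_Pair by simp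
    then have "- x = (T / period r) ^ 3 * spE r" unfolding q3 of_real_eq_iff .
    moreover have "(T / period r) ^ 3 * spE r < 0"
      using T period_pos[OF r] spE_neg[OF r] by (simp add: mult_pos_neg)
    ultimately show ?thesis using xv(2) by simp
  qed simp
qed

text \<open>Rotation by the inverse of the first control reduces to control 1 and is undone at the
  end.\<close>

lemma fixed_point_classification:
  assumes \<xi>: "\<xi> \<noteq> 0" "comp3 \<xi> \<in> walls" and ham: "ham_vanishes \<xi>"
    and fixed: "fuller_map \<xi> = virial (w, r) \<xi>" and w: "w \<in> V_T" and r: "r > 0"
  shows "spiral_ratio r \<and> (\<exists>v\<in>V_T. \<exists>k>0. \<xi> = virial (v, k) (q_rep r))"
proof -
  obtain u T where sw: "switches \<xi> u T" using switches_exists[OF \<xi>(1)] by blast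
  have u: "u \<in> V_T" using sw by (simp add: switches_def)
  define y where "y = virial (cnj u, 1) \<xi>"
  have uu: "cnj u * u = 1" "u * cnj u = 1" by (simp_all add: V_T_cnj_mult u)
  have "switches y 1 T"
    using switches_virial[OF sw V_T_cnj[OF u], of 1] by (simp add: y_def uu)
  moreover have "fuller_arc 1 y T = virial (w, r) y"
    using arc_virial[of "cnj u" u 1 \<xi> T] fixed
    by (simp add: y_def uu switches_fuller_map[OF sw] virial_virial mult.commute)
  moreover have "comp3 y \<in> walls" by (simp add: y_def walls_virial V_T_cnj \<xi> u)
  moreover have "fuller_ham y 1 = 0"
    using fuller_ham_virial[OF V_T_cnj[OF u], of 1 \<xi> u] ham
    by (simp add: y_def uu ham_vanishes_iff[OF sw])
  ultimately obtain k where k: "spiral_ratio r" "k > 0" "virial (zeta, 1) y = virial (1, k) (q_rep r)"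
    using normalized_fixed_point w r by blast
  have "\<xi> = virial (u * zeta\<^sup>2, 1) (virial (zeta, 1) y)"
  proof -
    have "u * zeta\<^sup>2 * (zeta * cnj u) = u * cnj u * (zeta\<^sup>2 * zeta)" by (simp only: ac_simps)
    then show ?thesis by (simp add: y_def virial_virial uu zeta_mult)
  qed
  also have "\<dots> = virial (u * zeta\<^sup>2, k) (q_rep r)" unfolding k(3) by (simp add: virial_virial)
  finally show ?thesis using k V_T_mult[OF u V_T_I(3)] by blast
qed

section \<open>Time reversal\<close>

lemma tau_virial: "tau (virial (w, r) z) = virial (cnj w, r) (tau z)"
  by (cases z) (simp add: tau_def virial_def)

lemma phi_tau: "phi (tau z) = phi z"
  by (cases z) (simp add: tau_def phi_def)

text \<open>Inverting \<open>r\<close> negates \<open>spB\<close> and \<open>spC\<close> and fixes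
  \<open>spD\<close> and \<open>spE\<close>, while \<open>tau\<close> negates exactly
  \<open>Im z1\<close> and \<open>Re z2\<close> here, the third coordinate being real.\<close>

lemma tau_q_rep:
  assumes "spiral_ratio r"
  shows "tau (q_rep r) = q_rep (1 / r)"
proof -
  have r: "r > 0" "poly spiral_poly r = 0" using assms by (auto simp: spiral_ratio_def)
  then have sr: "spiral_ratio (1 / r)" using spiral_root_inverse by (simp add: spiral_ratio_def)
  define i where "i = 1 / r"
  have i: "i > 0" "r * i = 1" using r by (simp_all add: i_def)
  note m = sp_mult[OF r(1)] sp_mult[OF i(1)]
  note d = spiral_denominators[OF r(1)] spiral_denominators[OF i(1)]
  have nz: "(1 + r) \<noteq> 0" "(1 + i) \<noteq> 0" "1 + r ^ 3 \<noteq> 0" "1 + i ^ 3 \<noteq> 0" using d by auto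
  have "(1 + r) * (1 + i) * (spB i + spB r) = 0" using m(1,6) i(2) by algebra
  then have B: "spB i = - spB r" using nz by simp
  have "(1 + r ^ 3) * (1 + i ^ 3) * (spC i + spC r) = 0" using m(2,7) i(2) by algebra
  then have C: "spC i = - spC r" using nz by simp
  have D: "spD i = spD r"
  proof -
    have "3 * (1 + r) * (1 + r ^ 3) * spD i = r ^ 4 * (3 * (1 + i) * (1 + i ^ 3) * spD i)"
      using i(2) by algebra
    also have "\<dots> = 3 * (1 + r) * (1 + r ^ 3) * spD r" unfolding m(3,8) using i(2) by algebra
    finally show ?thesis using nz by simp
  qed
  have E: "spE i = spE r"
    using sp_eqs(5)[OF r(1)] sp_eqs(5)[OF i(1)] by (simp add: B C D)
  show ?thesis
    unfolding q_rep_eq[OF assms] q_rep_eq[OF sr] unfolding i_def[symmetric] B C D E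
    by (simp add: tau_def complex_eq_iff)
qed

section \<open>Fixed classes of the angular map\<close>

definition spiral_class :: "real \<Rightarrow> state set" where
  "spiral_class r = V_rel `` {ang (q_rep r)}"

lemma q_rep_walls:
  assumes "spiral_ratio r"
  shows "q_rep r \<noteq> 0" "comp3 (q_rep r) \<in> walls" "ang (q_rep r) \<in> Xi_W" "phi (q_rep r) > 0"
  using virial_spiral_point(4,5)[OF assms, of 1 1] by (simp_all add: ang_in_Xi_W phi_pos)

lemma spiral_class_eq:
  assumes "spiral_ratio r"
  shows "spiral_class r = (\<lambda>w. virial (w, inverse (phi (q_rep r))) (q_rep r)) ` V_T"
  unfolding spiral_class_def V_rel_orbit[OF q_rep_walls(3)[OF assms]] by (simp add: ang_def virial_virial)

lemma spiral_class_memE: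
  assumes "spiral_ratio r" "\<xi> \<in> spiral_class r"
  obtains w where "w \<in> V_T" "\<xi> = virial (w, inverse (phi (q_rep r))) (q_rep r)"
  using assms(2) unfolding spiral_class_eq[OF assms(1)] by blast

lemma spiral_class_props:
  assumes sr: "spiral_ratio r"
  shows spiral_class_quotient: "spiral_class r \<in> Xi_W // V_rel"
    and spiral_class_fixed: "F_ang (spiral_class r) = spiral_class r"
    and spiral_class_ham: "\<forall>\<xi>\<in>spiral_class r. ham_vanishes \<xi>"
proof -
  let ?k = "inverse (phi (q_rep r))"
  have r: "r > 0" using sr by (simp add: spiral_ratio_def)
  have k: "?k > 0" using q_rep_walls(4)[OF sr] by simp
  show "spiral_class r \<in> Xi_W // V_rel"
    unfolding spiral_class_def using q_rep_walls(3)[OF sr] by (rule quotientI)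
  show "\<forall>\<xi>\<in>spiral_class r. ham_vanishes \<xi>"
    unfolding spiral_class_eq[OF sr] using virial_spiral_point(3)[OF sr _ k] by blast
  have "V_rel `` {ang (fuller_map \<xi>)} = spiral_class r" if \<xi>: "\<xi> \<in> spiral_class r" for \<xi>
  proof -
    obtain w where w: "w \<in> V_T" "\<xi> = virial (w, ?k) (q_rep r)" by (rule spiral_class_memE[OF sr \<xi>])
    note point = virial_spiral_point[OF sr w(1) k, folded w(2)]
    have "fuller_map \<xi> = virial (zeta\<^sup>2, r) \<xi>"
      unfolding switches_fuller_map[OF point(1)] by (rule point(2))
    then have "ang (fuller_map \<xi>) = virial (zeta\<^sup>2 * w, 1) (ang (q_rep r))"
      unfolding w(2) virial_virial by (simp only: ang_virial[OF V_T_mult[OF V_T_I(3) w(1)] mult_pos_pos[OF r k]])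
    then have "(ang (q_rep r), ang (fuller_map \<xi>)) \<in> V_rel"
      unfolding V_rel_iff using q_rep_walls(3)[OF sr] V_T_mult[OF V_T_I(3) w(1)] by blast
    from equiv_class_eq[OF equiv_V_rel this] show ?thesis unfolding spiral_class_def ..
  qed
  moreover have "spiral_class r \<noteq> {}" unfolding spiral_class_eq[OF sr] by (simp add: V_T_def)
  ultimately show "F_ang (spiral_class r) = spiral_class r" unfolding F_ang_def by simp
qed

text \<open>Invariance of the class gives one member whose image has its angular component in the
  same orbit. Restoring the scale \<open>k\<close> of the image turns this into the equation
  classified above, with ratio \<open>k\<close>.\<close>

lemma fixed_class_is_spiral:
  assumes X: "X \<in> Xi_W // V_rel" "F_ang X = X" "\<forall>\<xi>\<in>X. ham_vanishes \<xi>"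
  obtains r where "spiral_ratio r" "X = spiral_class r"
proof -
  obtain x where x: "x \<in> Xi_W" "X = V_rel `` {x}" using X(1) by (rule quotientE)
  have "x \<in> X" unfolding x(2) using x(1) equiv_class_self[OF equiv_V_rel] by simp
  then obtain \<xi> where \<xi>: "\<xi> \<in> X" "x \<in> V_rel `` {ang (fuller_map \<xi>)}"
    using X(2) unfolding F_ang_def by blast
  have rel: "(x, \<xi>) \<in> V_rel" "(ang (fuller_map \<xi>), x) \<in> V_rel" using \<xi> x(2) by simp_all
  then have \<xi>W: "\<xi> \<in> Xi_W" unfolding V_rel_def by blast
  have "(\<xi>, ang (fuller_map \<xi>)) \<in> V_rel"
    using equiv_V_rel rel unfolding equiv_def by (meson symD transD)
  then obtain w where w: "w \<in> V_T" "ang (fuller_map \<xi>) = virial (w, 1) \<xi>"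
    unfolding V_rel_iff by blast
  define k where "k = phi (fuller_map \<xi>)"
  have "fuller_map \<xi> \<noteq> 0"
  proof
    assume "fuller_map \<xi> = 0"
    moreover have "ang 0 = 0" by (simp add: ang_def virial_def zero_prod_def)
    ultimately show False using Xi_W_nonzero[OF Xi_W_virial[OF \<xi>W w(1)]] w(2) by simp
  qed
  then have k: "k > 0" by (simp add: k_def phi_pos)
  have "fuller_map \<xi> = virial (1, k) (ang (fuller_map \<xi>))"
    using k unfolding ang_def virial_virial k_def by simp
  then have closes: "fuller_map \<xi> = virial (w, k) \<xi>" unfolding w(2) virial_virial by simp
  have "comp3 \<xi> \<in> walls" using \<xi>W by (simp add: Xi_W_def)
  then obtain v c where v: "spiral_ratio k" "v \<in> V_T" "c > 0" "\<xi> = virial (v, c) (q_rep k)"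
    using fixed_point_classification[OF Xi_W_nonzero[OF \<xi>W] _ bspec[OF X(3) \<xi>(1)] closes w(1) k] by blast
  have "\<xi> = ang \<xi>" using ang_Xi_W[OF \<xi>W] ..
  also have "\<dots> = virial (v, 1) (ang (q_rep k))" unfolding v(4) by (rule ang_virial[OF v(2,3)])
  finally have "(ang (q_rep k), \<xi>) \<in> V_rel"
    unfolding V_rel_iff using q_rep_walls(3)[OF v(1)] v(2) by blast
  then have "spiral_class k = V_rel `` {\<xi>}"
    unfolding spiral_class_def by (rule equiv_class_eq[OF equiv_V_rel])
  also have "\<dots> = X"
    unfolding x(2) using equiv_class_eq[OF equiv_V_rel rel(1)] ..
  finally show ?thesis using that v(1) by blast
qed

lemma spiral_class_trajectory:
  assumes sr: "spiral_ratio r" and \<xi>: "\<xi> \<in> spiral_class r"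
  shows "\<exists>z s. triangular_spiral z s (zeta\<^sup>2, r) \<and> z (s 0) = \<xi> \<and> (\<forall>n. ang (z (s n)) \<in> spiral_class r)"
proof -
  let ?k = "inverse (phi (q_rep r))"
  have r: "r > 0" using sr by (simp add: spiral_ratio_def)
  have k: "?k > 0" using q_rep_walls(4)[OF sr] by simp
  obtain w where w: "w \<in> V_T" "\<xi> = virial (w, ?k) (q_rep r)" by (rule spiral_class_memE[OF sr \<xi>])
  note point = virial_spiral_point[OF sr w(1) k, folded w(2)]
  obtain z s where z: "triangular_spiral z s (zeta\<^sup>2, r)"
    "\<And>n. z (s n) = virial ((zeta\<^sup>2) ^ n, r ^ n) \<xi>"
    using spiral_trajectory[OF point(1,2) V_T_I(3) r point(4,5)] by blast
  have "ang (z (s n)) \<in> spiral_class r" for n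
  proof -
    have v: "(zeta\<^sup>2) ^ n \<in> V_T" "r ^ n > 0" using V_T_power[OF V_T_I(3)] r by simp_all
    then have "ang (z (s n)) = virial ((zeta\<^sup>2) ^ n * w, 1) (ang (q_rep r))"
      unfolding z(2) w(2) virial_virial by (intro ang_virial V_T_mult mult_pos_pos w(1) k)
    then show ?thesis
      unfolding spiral_class_def V_rel_orbit[OF q_rep_walls(3)[OF sr]] using V_T_mult[OF v(1) w(1)] by blast
  qed
  then show ?thesis using z by (metis power_0 virial_1)
qed

lemma tau_spiral_class:
  assumes "spiral_ratio r"
  shows "tau ` spiral_class r = spiral_class (1 / r)"
proof -
  have sr: "spiral_ratio (1 / r)" using assms spiral_root_inverse by (simp add: spiral_ratio_def)
  let ?f = "\<lambda>w. virial (w, inverse (phi (q_rep r))) (tau (q_rep r))"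
  have cnj: "cnj ` V_T = V_T"
  proof
    show "cnj ` V_T \<subseteq> V_T" using V_T_cnj by blast
    show "V_T \<subseteq> cnj ` V_T"
    proof
      fix w assume "w \<in> V_T"
      then show "w \<in> cnj ` V_T" using V_T_cnj by (intro image_eqI[of _ _ "cnj w"]) simp_all
    qed
  qed
  have "tau ` spiral_class r = ?f ` cnj ` V_T"
    unfolding spiral_class_eq[OF assms] image_image tau_virial ..
  also have "\<dots> = spiral_class (1 / r)"
    unfolding cnj spiral_class_eq[OF sr] tau_q_rep[OF assms, symmetric] phi_tau ..
  finally show ?thesis .
qed

text \<open>If the classes agreed, the real nonzero third coordinates would force the rotation to be
  1 and the first real parts \<open>- 1\<close> would force equal scales. But \<open>spB\<close> is
  positive at \<open>r\<close> and negative at \<open>1 / r\<close>.\<close>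

lemma spiral_class_neq:
  assumes sr: "spiral_ratio r" and r1: "r > 1"
  shows "spiral_class r \<noteq> spiral_class (1 / r)"
proof
  assume eq: "spiral_class r = spiral_class (1 / r)"
  have sr': "spiral_ratio (1 / r)" using sr spiral_root_inverse by (simp add: spiral_ratio_def)
  obtain w where w: "w \<in> V_T" "virial (1, inverse (phi (q_rep r))) (q_rep r)
      = virial (w, inverse (phi (q_rep (1 / r)))) (q_rep (1 / r))"
    using eq unfolding spiral_class_eq[OF sr] spiral_class_eq[OF sr'] using V_T_I(1) by blast
  define a b where "a = inverse (phi (q_rep r))" and "b = inverse (phi (q_rep (1 / r)))"
  have ab: "a > 0" "b > 0" using q_rep_walls(4) sr sr' by (simp_all add: a_def b_def)
  have r: "r > 0" "1 / r > 0" using r1 by simp_all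
  have e1: "of_real a * Complex (- 1) (sqrt 3 * spB r) = w * of_real b * Complex (- 1) (sqrt 3 * spB (1 / r))"
    and e3: "of_real (a ^ 3 * spE r) = w * of_real (b ^ 3 * spE (1 / r))"
    using w(2)[folded a_def b_def] unfolding q_rep_eq[OF sr] q_rep_eq[OF sr'] virial_Pair
    by (simp_all add: mult.assoc)
  have "b ^ 3 * spE (1 / r) \<noteq> 0" using ab(2) spE_neg[OF r(2)] by simp
  then have "Im w = 0" using arg_cong[OF e3, of Im] by simp
  then have "w = 1" using w(1) by (auto simp: V_T_def)
  have "a = b" using arg_cong[OF e1, of Re] \<open>w = 1\<close> by simp
  then have "spB r = spB (1 / r)" using arg_cong[OF e1, of Im] \<open>w = 1\<close> ab by simp
  moreover have "spB r > 0" "spB (1 / r) < 0" using r1 by (simp_all add: spB_def divide_neg_pos add_pos_pos)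
  ultimately show False by simp
qed

lemma period_r_scale: "\<bar>period r_scale - 7.4\<bar> < 0.05"
proof -
  \<comment> \<open>This is \<open>(1 + r + r ^ 2) / (1 + r)\<close> at \<open>r_scale\<close>,
    split so that the bounds on the root bound each summand.\<close>
  define x where "x = r_scale + 1 / (1 + r_scale)"
  have r: "6.27 \<le> r_scale" "r_scale \<le> 6.2749" using r_scale_props by auto
  have "1 / (1 + r_scale) \<le> 1 / 7.27" "1 / 7.2749 \<le> 1 / (1 + r_scale)"
    using r by (intro divide_left_mono; simp)+
  then have x: "6.4 \<le> x" "x \<le> 6.42" using r unfolding x_def by simp_all
  have "spT r_scale = 2 / 3 * x"
    using r by (simp add: spT_def x_def field_simps power2_eq_square)
  then have p: "period r_scale = 2 / 3 * (sqrt 3 * x)" by (simp add: period_def)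
  have "1.732 \<le> sqrt 3" by (rule real_le_rsqrt) (simp add: power2_eq_square)
  moreover have "sqrt 3 \<le> 1.7321" by (rule real_le_lsqrt) (simp_all add: power2_eq_square)
  ultimately have "1.732 * 6.4 \<le> sqrt 3 * x" "sqrt 3 * x \<le> 1.7321 * 6.42"
    using x by (intro mult_mono; simp)+
  then show ?thesis unfolding p by (simp add: abs_if)
qed

theorem lemma13p5p2:
  shows "reflect_poly spiral_poly = spiral_poly
    \<and> (\<exists>!r::real. r > 1 \<and> poly spiral_poly r = 0)
    \<and> \<bar>r_scale - 6.27\<bar> < 0.005
    \<and> (\<exists>Q_out Q_in.
          Q_out \<noteq> Q_in
        \<and> {X \<in> Xi_W // V_rel. F_ang X = X \<and> (\<forall>\<xi>\<in>X. ham_vanishes \<xi>)} = {Q_out, Q_in}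
        \<and> (\<forall>\<xi>\<in>Q_out. \<exists>z s w. outward_spiral z s (w, r_scale) \<and> z (s 0) = \<xi>
              \<and> (\<forall>n. ang (z (s n)) \<in> Q_out))
        \<and> (\<forall>\<xi>\<in>Q_in. \<exists>z s g. inward_spiral z s g \<and> z (s 0) = \<xi>
              \<and> (\<forall>n. ang (z (s n)) \<in> Q_in))
        \<and> tau ` Q_out = Q_in
        \<and> (\<forall>\<xi>\<in>Q_out. \<exists>g\<in>virial_group. virial g \<xi> = q_rep r_scale))
    \<and> t_sw (q_rep r_scale) = 2 * (1 + r_scale + r_scale ^ 2) / (sqrt 3 * (r_scale + 1))
    \<and> \<bar>t_sw (q_rep r_scale) - 7.4\<bar> < 0.05"
proof -
  let ?r = "r_scale"
  have out: "spiral_ratio ?r" and in': "spiral_ratio (1 / ?r)"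
    by (simp_all add: spiral_ratio_iff)
  have t_sw: "t_sw (q_rep ?r) = period ?r"
    by (rule switches_t_sw[OF q_rep_switches[OF out]])
  have palindromic: "reflect_poly spiral_poly = spiral_poly"
    by (simp add: spiral_poly_def reflect_poly_def)
  have approx: "\<bar>?r - 6.27\<bar> < 0.005" using r_scale_props by (simp add: abs_if)
  have classes: "{X \<in> Xi_W // V_rel. F_ang X = X \<and> (\<forall>\<xi>\<in>X. ham_vanishes \<xi>)}
      = {spiral_class ?r, spiral_class (1 / ?r)}" (is "?fixed = ?classes")
  proof
    show "?fixed \<subseteq> ?classes"
    proof
      fix X assume "X \<in> ?fixed"
      then obtain r where "spiral_ratio r" "X = spiral_class r"
        using fixed_class_is_spiral by blast
      then show "X \<in> ?classes" unfolding spiral_ratio_iff by blast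
    qed
    show "?classes \<subseteq> ?fixed"
      using spiral_class_props[OF out] spiral_class_props[OF in'] by blast
  qed
  have outward: "\<exists>z s w. outward_spiral z s (w, ?r) \<and> z (s 0) = \<xi> \<and> (\<forall>n. ang (z (s n)) \<in> spiral_class ?r)"
    if "\<xi> \<in> spiral_class ?r" for \<xi>
    using spiral_class_trajectory[OF out that] r_scale_props(1) unfolding outward_spiral_def snd_conv by blast
  have inward: "\<exists>z s g. inward_spiral z s g \<and> z (s 0) = \<xi> \<and> (\<forall>n. ang (z (s n)) \<in> spiral_class (1 / ?r))"
    if "\<xi> \<in> spiral_class (1 / ?r)" for \<xi>
  proof -
    have "snd (zeta\<^sup>2, 1 / ?r) < 1" using r_scale_props(1) by simp
    then show ?thesis using spiral_class_trajectory[OF in' that] unfolding inward_spiral_def by blast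
  qed
  have rescaled: "\<exists>g\<in>virial_group. virial g \<xi> = q_rep ?r" if \<xi>: "\<xi> \<in> spiral_class ?r" for \<xi>
  proof -
    obtain w where w: "w \<in> V_T" "\<xi> = virial (w, inverse (phi (q_rep ?r))) (q_rep ?r)"
      by (rule spiral_class_memE[OF out \<xi>])
    have "virial (cnj w, phi (q_rep ?r)) \<xi> = q_rep ?r"
      using q_rep_walls(4)[OF out] by (simp add: w virial_virial V_T_cnj_mult)
    then show ?thesis
      using V_T_cnj[OF w(1)] q_rep_walls(4)[OF out] by (auto simp: virial_group_def)
  qed
  show ?thesis
    unfolding t_sw
    by (intro conjI exI[of _ "spiral_class ?r"] exI[of _ "spiral_class (1 / ?r)"] ballI
        palindromic spiral_root_ex1 approx spiral_class_neq[OF out r_scale_props(1)] classes outward inward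
        tau_spiral_class[OF out] rescaled period_eq period_r_scale)
qed

end
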